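(* Let $(A(n))_{n\in\mathbb{N}}$ be a stationary and ergodic sequence of random matrices with values in $\mathbb{R}_{\max}^{d\times d}$, with no line of $-\infty$, such that $\max_{ij}A_{ij}^+(0)$ is integrable (where $a^+=\max(a,0)$). Let $c_1,\dots,c_K$ be the components of $\mathcal{G}(A)$. (1) If the almost-sure limit of $\left(\frac1n y(n,0)\right)_{n\in\mathbb{N}}$ is deterministic (i.e. almost surely equal to a constant vector of $\mathbb{R}_{\max}^d$), then it is given by $$\forall m\in\{1,\dots,K\},\quad \lim_n\frac1n y^{c_m}(n,0)=\gamma^{[m]}\mathbf{1}\quad\text{a.s.},$$ and, that being the case, for every component $c_m$ of $\mathcal{G}(A)$, the random matrix $A^{\{m\}}(0)$ has no line of $-\infty$. (2) If $\left(\frac1n x(n,0)\right)_{n\in\mathbb{N}}$ converges almost surely, then its limit is deterministic and is equal to that of $\left(\frac1n y(n,0)\right)_{n\in\mathbb{N}}$; that is, $$\forall m\in\{1,\dots,K\},\quad \lim_n\frac1n x^{c_m}(n,0)=\gamma^{[m]}\mathbf{1}\quad\text{a.s.}$$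
   Context: Max-plus conventions. $\mathbb{R}_{\max}=\mathbb{R}\cup\{-\infty\}$ is the semi-ring with addition $\max$ and multiplication $+$. Products are max-plus: $(Ax)_i=\max_j(A_{ij}+x_j)$, $(AB)_{ij}=\max_k(A_{ik}+B_{kj})$. $0$ denotes the vector with all coordinates $0$ and $\mathbf{1}$ the vector with all coordinates $1$; $\gamma\mathbf 1$ is the vector with all coordinates equal to $\gamma\in\mathbb{R}_{\max}$. $\mathbb{N}=\{0,1,2,\dots\}$. Limits are taken in $\mathbb{R}_{\max}=[-\infty,+\infty)$, so convergence to $-\infty$ is allowed. A random matrix has "no line of $-\infty$" if almost surely each of its rows contains an entry different from $-\infty$. Sequences. Put $A^n:=A(n-1)A(n-2)\cdots A(0)$ and $x(n,0):=A^n0$. The stationary sequence is extended, up to a change of probability space, to a stationary sequence $(A(n))_{n\in\mathbb{Z}}$, and $y(n,0):=A(-1)A(-2)\cdots A(-n)\,0$. It is a known fact (Bousch and Mairesse) that under the hypotheses of the statement $\left(\frac1n y(n,0)\right)_n$ converges almost surely in $\mathbb{R}_{\max}^d$. For $I\subset\{1,\dots,d\}$ and a vector $x$, $x^I:=(x_i)_{i\in I}$. Maximal Lyapunov exponent. For a stationary ergodic sequence of (square) random matrices $(M(n))$ with entries in $\mathbb{R}_{\max}$ (rows of $-\infty$ allowed) with $\max_{ij}M^+_{ij}(0)$ integrable, $\frac1n\max_{i,j}(M(n-1)\cdots M(0))_{ij}$ converges a.s. to a constant $\gamma(M)\in\mathbb{R}_{\max}$, the maximal Lyapunov exponent. Graph.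 $\mathcal{G}(A)$ is the directed graph with nodes $1,\dots,d$ and arcs the pairs $(i,j)$ with $\mathbb{P}(A_{ij}(0)\neq-\infty)>0$. Its strongly connected components (called components) are $c_1,\dots,c_K$ (a component may be a single node without loop). Write $m\rightarrow l$ if $m=l$ or there is a path in $\mathcal{G}(A)$ from a node of $c_m$ to a node of $c_l$. For each $m$ define: $\gamma^{(m)}:=\gamma\big((A_{ij}(n))_{i,j\in c_m}\big)$; $E_m:=\{l: m\rightarrow l\}$; $\gamma^{[m]}:=\max_{l\in E_m}\gamma^{(l)}$; $G_m:=\{l\in E_m: \exists p,\ m\rightarrow l\rightarrow p,\ \gamma^{(p)}=\gamma^{[m]}\}$; $H_m:=\bigcup_{l\in G_m}c_l$; $A^{\{m\}}(n):=(A_{ij}(n))_{i,j\in H_m}$. *)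

theory Defs
  imports "HOL-Probability.Probability" "Graph_Theory.Graph_Theory"
begin

text \<open>
  \<open>\<real>\<close> with \<open>-\<infinity>\<close> adjoined is the set of \<open>x :: ereal\<close> with \<open>x \<noteq> \<infinity>\<close>. Suprema over the finite
  index sets below are maxima; over the empty set they give \<open>-\<infinity>\<close>, the max-plus zero.
\<close>

definition mp_apply :: "ereal^'d^'d \<Rightarrow> ereal^'d \<Rightarrow> ereal^'d" where
  "mp_apply A x = (\<chi> i. SUP j. A $ i $ j + x $ j)"

text \<open>
  \<open>mp_mult J A B\<close> has on \<open>J \<times> J\<close> the entries of the max-plus product of the submatrices
  of \<open>A\<close> and \<open>B\<close> indexed by \<open>J\<close>; its entries outside \<open>J \<times> J\<close> are irrelevant.
\<close>

definition mp_mult :: "'d set \<Rightarrow> ereal^'d^'d \<Rightarrow> ereal^'d^'d \<Rightarrow> ereal^'d^'d" where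
  "mp_mult J A B = (\<chi> i j. SUP k\<in>J. A $ i $ k + B $ k $ j)"

definition mp_one :: "ereal^'d^'d" where
  "mp_one = (\<chi> i j. if i = j then 0 else -\<infinity>)"

text \<open>\<open>mp_prod J S n\<close> is \<open>S (n-1) \<cdots> S 1 S 0\<close>, computed with the submatrices indexed by \<open>J\<close>.\<close>

primrec mp_prod :: "'d set \<Rightarrow> (nat \<Rightarrow> ereal^'d^'d) \<Rightarrow> nat \<Rightarrow> ereal^'d^'d" where
  "mp_prod J S 0 = mp_one"
| "mp_prod J S (Suc n) = mp_mult J (S n) (mp_prod J S n)"

text \<open>Convergence in \<open>[-\<infinity>, \<infinity>)\<close>.\<close>

definition rmax_lim :: "(nat \<Rightarrow> ereal) \<Rightarrow> ereal \<Rightarrow> bool" where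
  "rmax_lim X l \<longleftrightarrow> l \<noteq> \<infinity> \<and> X \<longlonglongrightarrow> l"


definition rmax_random_matrix :: "'a measure \<Rightarrow> ('a \<Rightarrow> ereal^'d^'d) \<Rightarrow> bool" where
  "rmax_random_matrix M X \<longleftrightarrow>
     X \<in> borel_measurable M \<and> (\<forall>\<omega>\<in>space M. \<forall>i j. X \<omega> $ i $ j \<noteq> \<infinity>)"

definition no_bot_line :: "'a measure \<Rightarrow> 'd set \<Rightarrow> ('a \<Rightarrow> ereal^'d^'d) \<Rightarrow> bool" where
  "no_bot_line M J X \<longleftrightarrow> (AE \<omega> in M. \<forall>i\<in>J. \<exists>j\<in>J. X \<omega> $ i $ j \<noteq> -\<infinity>)"

definition path_law ::
    "'a measure \<Rightarrow> ('t \<Rightarrow> 'a \<Rightarrow> 'b::topological_space) \<Rightarrow> ('t \<Rightarrow> 'b) measure" where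
  "path_law M A = distr M (\<Pi>\<^sub>M t\<in>UNIV. borel) (\<lambda>\<omega> t. A t \<omega>)"

definition stationary ::
    "'a measure \<Rightarrow> ('t::{plus,one} \<Rightarrow> 'a \<Rightarrow> 'b::topological_space) \<Rightarrow> bool" where
  "stationary M A \<longleftrightarrow> path_law M (\<lambda>t. A (t + 1)) = path_law M A"

text \<open>Every shift-invariant event of the path space has probability 0 or 1.\<close>

definition ergodic ::
    "'a measure \<Rightarrow> ('t::{plus,one} \<Rightarrow> 'a \<Rightarrow> 'b::topological_space) \<Rightarrow> bool" where
  "ergodic M A \<longleftrightarrow>
     (\<forall>S \<in> sets (\<Pi>\<^sub>M t\<in>UNIV. borel). (\<lambda>u t. u (t + 1)) -` S = S \<longrightarrow>
        measure (path_law M A) S \<in> {0, 1})"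

text \<open>
  \<open>B\<close> is an extension of \<open>A\<close> to a stationary sequence indexed by the integers, possibly living
  on another probability space \<open>N\<close>.
\<close>

definition stationary_extension ::
    "'a measure \<Rightarrow> (nat \<Rightarrow> 'a \<Rightarrow> ereal^'d^'d) \<Rightarrow> 'b measure \<Rightarrow> (int \<Rightarrow> 'b \<Rightarrow> ereal^'d^'d) \<Rightarrow> bool"
  where
  "stationary_extension M A N B \<longleftrightarrow>
     prob_space N \<and> (\<forall>n. rmax_random_matrix N (B n)) \<and> stationary N B \<and>
     path_law N (\<lambda>n. B (int n)) = path_law M A"

definition x_seq :: "(nat \<Rightarrow> 'a \<Rightarrow> ereal^'d^'d) \<Rightarrow> nat \<Rightarrow> 'a \<Rightarrow> ereal^'d" where
  "x_seq A n \<omega> = mp_apply (mp_prod UNIV (\<lambda>k. A k \<omega>) n) 0"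

text \<open>The factors for \<open>k = n-1, \<dots>, 0\<close> are \<open>B (-1), \<dots>, B (-n)\<close>, in this order.\<close>

definition y_seq :: "(int \<Rightarrow> 'a \<Rightarrow> ereal^'d^'d) \<Rightarrow> nat \<Rightarrow> 'a \<Rightarrow> ereal^'d" where
  "y_seq B n \<omega> = mp_apply (mp_prod UNIV (\<lambda>k. B (int k - int n) \<omega>) n) 0"

text \<open>
  The maximal Lyapunov exponent of the sequence of submatrices indexed by \<open>J\<close>: the constant to
  which the normalised maximal entry of the product converges almost surely. It is unique because
  \<open>M\<close> is a probability space.
\<close>

definition lyapunov :: "'a measure \<Rightarrow> (nat \<Rightarrow> 'a \<Rightarrow> ereal^'d^'d) \<Rightarrow> 'd set \<Rightarrow> ereal" where
  "lyapunov M A J = (THE g. AE \<omega> in M.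
     rmax_lim (\<lambda>n. (SUP i\<in>J. SUP j\<in>J. mp_prod J (\<lambda>k. A k \<omega>) n $ i $ j) / ereal (real n)) g)"


definition mp_graph :: "'a measure \<Rightarrow> (nat \<Rightarrow> 'a \<Rightarrow> ereal^'d^'d) \<Rightarrow> ('d, 'd \<times> 'd) pre_digraph" where
  "mp_graph M A = with_proj
     \<lparr> pverts = UNIV,
       parcs = {(i, j). measure M {\<omega> \<in> space M. A 0 \<omega> $ i $ j \<noteq> -\<infinity>} > 0} \<rparr>"

definition sccs_of :: "'a measure \<Rightarrow> (nat \<Rightarrow> 'a \<Rightarrow> ereal^'d^'d) \<Rightarrow> 'd set set" where
  "sccs_of M A = pre_digraph.sccs_verts (mp_graph M A)"

text \<open>A component \<open>c\<^sub>m\<close> is represented by its node set, which replaces the index \<open>m\<close>.\<close>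

definition leads_to ::
    "'a measure \<Rightarrow> (nat \<Rightarrow> 'a \<Rightarrow> ereal^'d^'d) \<Rightarrow> 'd set \<Rightarrow> 'd set \<Rightarrow> bool" where
  "leads_to M A c c' \<longleftrightarrow> c = c' \<or> (\<exists>i\<in>c. \<exists>j\<in>c'. i \<rightarrow>\<^sup>*\<^bsub>mp_graph M A\<^esub> j)"

definition E_set :: "'a measure \<Rightarrow> (nat \<Rightarrow> 'a \<Rightarrow> ereal^'d^'d) \<Rightarrow> 'd set \<Rightarrow> 'd set set" where
  "E_set M A c = {c' \<in> sccs_of M A. leads_to M A c c'}"

text \<open>\<open>lyapunov M A c\<^sub>m\<close> is \<open>\<gamma>\<^sup>(\<^sup>m\<^sup>)\<close> and \<open>gamma_down M A c\<^sub>m\<close> is \<open>\<gamma>\<^sup>[\<^sup>m\<^sup>]\<close>.\<close>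

definition gamma_down :: "'a measure \<Rightarrow> (nat \<Rightarrow> 'a \<Rightarrow> ereal^'d^'d) \<Rightarrow> 'd set \<Rightarrow> ereal" where
  "gamma_down M A c = (MAX c'\<in>E_set M A c. lyapunov M A c')"

definition G_set :: "'a measure \<Rightarrow> (nat \<Rightarrow> 'a \<Rightarrow> ereal^'d^'d) \<Rightarrow> 'd set \<Rightarrow> 'd set set" where
  "G_set M A c = {c' \<in> E_set M A c. \<exists>p\<in>sccs_of M A.
     leads_to M A c c' \<and> leads_to M A c' p \<and> lyapunov M A p = gamma_down M A c}"

definition H_set :: "'a measure \<Rightarrow> (nat \<Rightarrow> 'a \<Rightarrow> ereal^'d^'d) \<Rightarrow> 'd set \<Rightarrow> 'd set" where
  "H_set M A c = \<Union> (G_set M A c)"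

end

theory Submission
  imports Defs
begin

text \<open>
  The entries of the products are maximal weights of walks driven by a measure-preserving map. Call
  a state losing at rate \<open>b\<close> if, for some \<open>m \<ge> 1\<close>, all its walks of length \<open>m\<close> weigh at most \<open>b m\<close>.
  A walk through losing states is cut greedily into pieces of average weight at most \<open>b\<close>. The times
  at which the next piece would be too long are rare, and by the maximal ergodic inequality they
  contribute at most \<open>\<epsilon> n\<close>, so the walk weighs at most \<open>(b + \<epsilon>) n\<close>. Hence for every \<open>b\<close> a node either
  sees only losing states, and the upper growth rate of its walks is at most \<open>b\<close>, or it reaches a
  state that is not losing, and the lower growth rate is at least \<open>b\<close>. This gives the theorem of
  Bousch and Mairesse on \<open>y(n,0)/n\<close> and the existence of the Lyapunov exponents. As a walk leaves each
  component at most once, it also gives \<open>limsup x\<^sub>i(n,0)/n \<le> \<gamma>\<^sup>[\<^sup>m\<^sup>]\<close> for \<open>i\<close> in \<open>c\<^sub>m\<close>.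

  Conversely, suppose that \<open>x(n,0)/n\<close> tends to a constant vector \<open>l\<close> in probability. Both parts reduce
  to this, since \<open>x(n,0)\<close> and \<open>y(n,0)\<close> have the same law. Then \<open>l\<^sub>i \<ge> l\<^sub>j\<close> along every arc \<open>(i, j)\<close> and
  \<open>l\<close> is at least \<open>\<gamma>\<^sup>(\<^sup>m\<^sup>)\<close> on \<open>c\<^sub>m\<close>, so \<open>l = \<gamma>\<^sup>[\<^sup>m\<^sup>]\<close> there. A row of \<open>-\<infinity>\<close> in \<open>A\<^sup>{\<^sup>m\<^sup>}(n)\<close> would force \<open>x\<^sub>i(n+1,0)\<close>
  through nodes where \<open>l\<close> is strictly smaller.
\<close>

section \<open>The maximal ergodic inequality\<close>

text \<open>Greedy cutting from \<open>t\<close> onwards: a time in \<open>S\<close> is passed by a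
  single step, whose excess \<open>h\<close> over \<open>b\<close> is charged; any other time starts
  a piece of average weight at most \<open>b\<close>, after which the cutting resumes. Times of
  \<open>S\<close> inside a piece cost nothing, but may be counted because \<open>h\<close> is
  nonnegative.\<close>

lemma covering_bound:
  fixes w :: "nat \<Rightarrow> ereal" and h :: "nat \<Rightarrow> real" and b :: real
  assumes step: "\<And>k. k < n \<Longrightarrow> w k \<le> ereal (b + h k)"
    and good: "\<And>k. k < n \<Longrightarrow> k \<notin> S \<Longrightarrow> \<exists>m\<ge>1. k + m \<le> n \<and> sum w {k..<k+m} \<le> ereal (b * real m)"
    and h: "\<And>k. 0 \<le> h k"
    and "t \<le> n"
  shows "sum w {t..<n} \<le> ereal (b * real (n - t) + sum h ({t..<n} \<inter> S))"
  using \<open>t \<le> n\<close>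
proof (induction "n - t" arbitrary: t rule: less_induct)
  case less
  show ?case
  proof (cases "t = n")
    case False
    then have "t < n" using less.prems by simp
    obtain m where m: "m \<ge> 1" "t + m \<le> n"
      and w: "sum w {t..<t+m} \<le> ereal (b * real m + sum h ({t..<t+m} \<inter> S))"
    proof (cases "t \<in> S")
      case True
      then have "{t..<t+1} \<inter> S = {t}" by auto
      then show thesis using that[of 1] step[OF \<open>t < n\<close>] \<open>t < n\<close> by simp
    next
      case False
      then obtain m where m: "m \<ge> 1" "t + m \<le> n" "sum w {t..<t+m} \<le> ereal (b * real m)"
        using good[OF \<open>t < n\<close>] by blast
      moreover have "0 \<le> sum h ({t..<t+m} \<inter> S)" by (simp add: h sum_nonneg)
      ultimately show thesis by (intro that[of m]) (auto elim: order_trans)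
    qed
    have "sum w {t..<n} = sum w {t..<t+m} + sum w {t+m..<n}"
      using m by (simp add: sum.atLeastLessThan_concat)
    also have "\<dots> \<le> ereal (b * real m + sum h ({t..<t+m} \<inter> S))
        + ereal (b * real (n - (t + m)) + sum h ({t+m..<n} \<inter> S))"
      using m by (intro add_mono w less.hyps) auto
    also have "{t..<n} \<inter> S = ({t..<t+m} \<inter> S) \<union> ({t+m..<n} \<inter> S)" using m by auto
    then have "sum h ({t..<n} \<inter> S) = sum h ({t..<t+m} \<inter> S) + sum h ({t+m..<n} \<inter> S)"
      by (simp only:) (rule sum.union_disjoint, auto)
    then have "ereal (b * real m + sum h ({t..<t+m} \<inter> S))
        + ereal (b * real (n - (t + m)) + sum h ({t+m..<n} \<inter> S))
        = ereal (b * real (n - t) + sum h ({t..<n} \<inter> S))"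
      using m by (simp add: of_nat_diff algebra_simps)
    finally show ?thesis .
  qed simp
qed

text \<open>Used for two maps: the forward shift on one-sided paths and the backward shift on
  two-sided paths.\<close>

locale measure_preserving_system = prob_space M for M :: "'w measure" +
  fixes T :: "'w \<Rightarrow> 'w"
  assumes T_measurable [measurable]: "T \<in> measurable M M"
    and distr_T: "distr M M T = M"
begin

lemma funpow_T_measurable [measurable]: "T ^^ k \<in> measurable M M"
  by (rule measurable_compose_n) (rule T_measurable)

lemma distr_funpow_T: "distr M M (T ^^ k) = M"
proof (induction k)
  case (Suc k)
  have "distr M M (T \<circ> T ^^ k) = distr (distr M M (T ^^ k)) M T"
    by (simp add: distr_distr)
  then show ?case by (simp only: Suc distr_T funpow.simps)
qed (simp add: distr_id2)

lemma funpow_T_in_space: "\<omega> \<in> space M \<Longrightarrow> (T ^^ k) \<omega> \<in> space M"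
  by (rule measurable_space[OF funpow_T_measurable])

lemma AE_funpow_T:
  assumes "AE \<omega> in M. P \<omega>"
  shows "AE \<omega> in M. \<forall>k. P ((T ^^ k) \<omega>)"
proof -
  have "AE \<omega> in M. P ((T ^^ k) \<omega>)" for k
    using assms by (intro AE_distrD[OF funpow_T_measurable]) (simp only: distr_funpow_T)
  then show ?thesis by (simp add: AE_all_countable)
qed

lemma integral_funpow_T:
  fixes f :: "'w \<Rightarrow> real"
  assumes [measurable]: "f \<in> borel_measurable M"
  shows "(\<integral>\<omega>. f ((T ^^ k) \<omega>) \<partial>M) = (\<integral>\<omega>. f \<omega> \<partial>M)"
  using integral_distr[of "T ^^ k" M M f] by (simp add: distr_funpow_T)

lemma integrable_funpow_T:
  fixes f :: "'w \<Rightarrow> real"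
  assumes "integrable M f"
  shows "integrable M (\<lambda>\<omega>. f ((T ^^ k) \<omega>))"
  using integrable_distr[OF funpow_T_measurable, of k f] assms by (simp add: distr_funpow_T)

text \<open>It is enough to bound the events \<open>E N\<close>, in which \<open>n\<close> is at
  most \<open>N\<close>, since they increase to the event in question. If the bound failed for
  \<open>E N\<close>, the function \<open>c\<close> times the indicator of \<open>E N\<close> minus
  \<open>g\<close> would have positive mean, although greedy covering bounds its sums along any
  orbit segment by \<open>c N\<close>.\<close>

lemma maximal_inequality:
  fixes g :: "'w \<Rightarrow> real"
  assumes int: "integrable M g" and nn: "\<And>\<omega>. 0 \<le> g \<omega>" and "0 < c"
  shows "prob {\<omega> \<in> space M. \<exists>n\<ge>1. c * real n \<le> (\<Sum>k<n. g ((T ^^ k) \<omega>))} \<le> (\<integral>\<omega>. g \<omega> \<partial>M) / c"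
proof -
  have [measurable]: "g \<in> borel_measurable M" using int by auto
  define E where "E N = {\<omega> \<in> space M. \<exists>n\<in>{1..N}. c * real n \<le> (\<Sum>k<n. g ((T ^^ k) \<omega>))}" for N :: nat
  have E_meas [measurable]: "E N \<in> sets M" for N unfolding E_def by measurable
  have bound: "c * prob (E N) \<le> (\<integral>\<omega>. g \<omega> \<partial>M)" for N
  proof (rule ccontr)
    assume "\<not> ?thesis"
    then have d: "0 < c * prob (E N) - (\<integral>\<omega>. g \<omega> \<partial>M)" by simp
    define f where "f \<omega> = c * indicator (E N) \<omega> - g \<omega>" for \<omega>
    have f_int: "integrable M f" unfolding f_def
      by (intro Bochner_Integration.integrable_diff integrable_mult_right int) (auto simp: integrable_indicator_iff emeasure_eq_measure)
    \<comment> \<open>Greedy covering: from a time in \<open>E N\<close> some sum of at most \<open>N\<close> values of \<open>f\<close> is nonpositive, and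
      elsewhere \<open>f\<close> itself is; only the last \<open>N\<close> times before \<open>R\<close> may be left uncovered.\<close>
    have f_le: "(\<Sum>k<R. f ((T ^^ k) \<omega>)) \<le> c * real N" if \<omega>: "\<omega> \<in> space M" for R \<omega>
    proof -
      have "(\<Sum>k=0..<R. ereal (f ((T ^^ k) \<omega>))) \<le>
        ereal (0 * real (R - 0) + sum (\<lambda>_. c) ({0..<R} \<inter> {k. R < k + N}))"
      proof (rule covering_bound)
        fix k assume "k < R"
        show "ereal (f ((T ^^ k) \<omega>)) \<le> ereal (0 + c)"
          using nn[of "(T ^^ k) \<omega>"] \<open>0 < c\<close> by (auto simp: f_def indicator_def)
        assume "k \<notin> {k. R < k + N}"
        then have kN: "k + N \<le> R" by simp
        show "\<exists>m\<ge>1. k + m \<le> R \<and> (\<Sum>i=k..<k+m. ereal (f ((T ^^ i) \<omega>))) \<le> ereal (0 * real m)"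
        proof (cases "(T ^^ k) \<omega> \<in> E N")
          case True
          then obtain m where m: "1 \<le> m" "m \<le> N" "c * real m \<le> (\<Sum>i<m. g ((T ^^ i) ((T ^^ k) \<omega>)))"
            unfolding E_def by auto
          have "(\<Sum>i=k..<k+m. f ((T ^^ i) \<omega>)) = (\<Sum>i<m. f ((T ^^ (i + k)) \<omega>))"
            using sum.shift_bounds_nat_ivl[of "\<lambda>i. f ((T ^^ i) \<omega>)" 0 k m]
            by (simp add: add.commute lessThan_atLeast0)
          also have "\<dots> \<le> (\<Sum>i<m. c - g ((T ^^ i) ((T ^^ k) \<omega>)))"
            using \<open>0 < c\<close> by (intro sum_mono) (auto simp: f_def funpow_add indicator_def)
          also have "\<dots> \<le> 0" using m by (simp add: sum_subtractf mult.commute)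
          finally show ?thesis using m kN by (intro exI[of _ m]) simp
        next
          case False
          then have "f ((T ^^ k) \<omega>) \<le> 0" using nn by (simp add: f_def)
          then show ?thesis using \<open>k < R\<close> by (intro exI[of _ 1]) simp
        qed
      qed (use \<open>0 < c\<close> in auto)
      then have "(\<Sum>k<R. f ((T ^^ k) \<omega>)) \<le> c * real (card ({0..<R} \<inter> {k. R < k + N}))"
        by (simp add: mult.commute lessThan_atLeast0)
      also have "card ({0..<R} \<inter> {k. R < k + N}) \<le> card {R - N..<R}"
        by (intro card_mono) auto
      then have "c * real (card ({0..<R} \<inter> {k. R < k + N})) \<le> c * real N"
        using \<open>0 < c\<close> by auto
      finally show ?thesis .
    qed
    \<comment> \<open>Integrating \<open>f_le\<close> and using invariance, \<open>R\<close> times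
      the positive mean stays below \<open>c N\<close> for every \<open>R\<close>, which fails for
      large \<open>R\<close>.\<close>
    have "real R * (c * prob (E N) - (\<integral>\<omega>. g \<omega> \<partial>M)) \<le> c * real N" for R
    proof -
      have "(\<integral>\<omega>. (\<Sum>k<R. f ((T ^^ k) \<omega>)) \<partial>M) \<le> (\<integral>\<omega>. c * real N \<partial>M)"
        by (rule integral_mono) (simp_all add: integrable_funpow_T[OF f_int] f_le)
      moreover have "(\<integral>\<omega>. (\<Sum>k<R. f ((T ^^ k) \<omega>)) \<partial>M) = (\<Sum>k<R. \<integral>\<omega>. f ((T ^^ k) \<omega>) \<partial>M)"
        by (rule Bochner_Integration.integral_sum) (rule integrable_funpow_T[OF f_int])
      moreover have "(\<integral>\<omega>. f ((T ^^ k) \<omega>) \<partial>M) = c * prob (E N) - (\<integral>\<omega>. g \<omega> \<partial>M)" for k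
      proof -
        have "(\<integral>\<omega>. f ((T ^^ k) \<omega>) \<partial>M) = (\<integral>\<omega>. f \<omega> \<partial>M)"
          using f_int by (intro integral_funpow_T) auto
        also have "\<dots> = c * prob (E N) - (\<integral>\<omega>. g \<omega> \<partial>M)"
          unfolding f_def using int
          by (subst Bochner_Integration.integral_diff) (auto simp: integrable_indicator_iff emeasure_eq_measure)
        finally show ?thesis .
      qed
      ultimately show ?thesis by (simp add: prob_space)
    qed
    moreover obtain R :: nat where "c * real N < real R * (c * prob (E N) - (\<integral>\<omega>. g \<omega> \<partial>M))"
      using reals_Archimedean3[OF d] by blast
    ultimately show False by (meson not_le)
  qed
  have "incseq E"
  proof (rule incseq_SucI)
    show "E N \<subseteq> E (Suc N)" for N by (force simp: E_def)
  qed
  then have "(\<lambda>N. prob (E N)) \<longlonglongrightarrow> prob (\<Union>N. E N)"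
    by (intro finite_Lim_measure_incseq) auto
  then have "prob (\<Union>N. E N) \<le> (\<integral>\<omega>. g \<omega> \<partial>M) / c"
    using bound \<open>0 < c\<close> by (intro LIMSEQ_le_const2) (auto simp: field_simps)
  also have "(\<Union>N. E N) = {\<omega> \<in> space M. \<exists>n\<ge>1. c * real n \<le> (\<Sum>k<n. g ((T ^^ k) \<omega>))}"
    by (auto simp: E_def) (metis atLeastAtMost_iff order_refl)
  finally show ?thesis .
qed

text \<open>For a given \<open>e\<close>, the points at which every \<open>K\<close> fails lie, for
  each \<open>K\<close>, in an event whose probability is at most the integral of \<open>g K\<close>
  divided by \<open>e\<close>, by the maximal inequality. They form a null set, and it is enough to
  let \<open>e\<close> run through the numbers \<open>1 / (j + 1)\<close>.\<close>

lemma AE_small_averages: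
  fixes g :: "nat \<Rightarrow> 'w \<Rightarrow> real"
  assumes int: "\<And>K. integrable M (g K)" and nn: "\<And>K \<omega>. 0 \<le> g K \<omega>"
    and lim: "(\<lambda>K. \<integral>\<omega>. g K \<omega> \<partial>M) \<longlonglongrightarrow> 0"
  shows "AE \<omega> in M. \<forall>e>0. \<exists>K. \<forall>n. (\<Sum>k<n. g K ((T ^^ k) \<omega>)) \<le> e * real n"
proof -
  have [measurable]: "g K \<in> borel_measurable M" for K using int by auto
  have *: "AE \<omega> in M. \<exists>K. \<forall>n\<ge>1. (\<Sum>k<n. g K ((T ^^ k) \<omega>)) < e * real n" if "0 < e" for e
  proof -
    define E where "E K = {\<omega> \<in> space M. \<exists>n\<ge>1. e * real n \<le> (\<Sum>k<n. g K ((T ^^ k) \<omega>))}" for K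
    have [measurable]: "E K \<in> sets M" for K unfolding E_def by measurable
    have "prob (\<Inter>K. E K) \<le> (\<integral>\<omega>. g K \<omega> \<partial>M) / e" for K
    proof -
      have "prob (\<Inter>K. E K) \<le> prob (E K)" by (intro finite_measure_mono) auto
      also have "\<dots> \<le> (\<integral>\<omega>. g K \<omega> \<partial>M) / e"
        unfolding E_def by (rule maximal_inequality[OF int nn that])
      finally show ?thesis .
    qed
    moreover have "(\<lambda>K. (\<integral>\<omega>. g K \<omega> \<partial>M) / e) \<longlonglongrightarrow> 0 / e"
      using that by (intro tendsto_divide lim) auto
    ultimately have "prob (\<Inter>K. E K) \<le> 0"
      by (intro LIMSEQ_le_const[of "\<lambda>K. (\<integral>\<omega>. g K \<omega> \<partial>M) / e"]) auto
    then have "prob (\<Inter>K. E K) = 0" by (simp add: measure_le_0_iff)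
    then have "AE \<omega> in M. \<omega> \<notin> (\<Inter>K. E K)"
      by (intro AE_not_in) (auto simp: null_sets_def emeasure_eq_measure)
    then show ?thesis
      proof (rule AE_mp, intro AE_I2 impI)
      fix \<omega> assume "\<omega> \<in> space M" "\<omega> \<notin> (\<Inter>K. E K)"
      then obtain K where "\<omega> \<notin> E K" by auto
      with \<open>\<omega> \<in> space M\<close> show "\<exists>K. \<forall>n\<ge>1. (\<Sum>k<n. g K ((T ^^ k) \<omega>)) < e * real n"
        by (intro exI[of _ K]) (simp add: E_def not_le, metis One_nat_def not_one_le_zero)
    qed
  qed
  have "AE \<omega> in M. \<forall>j. \<exists>K. \<forall>n\<ge>1. (\<Sum>k<n. g K ((T ^^ k) \<omega>)) < inverse (real (Suc j)) * real n"
    unfolding AE_all_countable by (intro allI *) simp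
  then show ?thesis
  proof (rule AE_mp, intro AE_I2 impI allI)
    fix \<omega> and e :: real
    assume a: "\<forall>j. \<exists>K. \<forall>n\<ge>1. (\<Sum>k<n. g K ((T ^^ k) \<omega>)) < inverse (real (Suc j)) * real n" and "0 < e"
    obtain j where j: "inverse (real (Suc j)) < e" using \<open>0 < e\<close> reals_Archimedean by blast
    obtain K where K: "\<forall>n\<ge>1. (\<Sum>k<n. g K ((T ^^ k) \<omega>)) < inverse (real (Suc j)) * real n" using a by blast
    show "\<exists>K. \<forall>n. (\<Sum>k<n. g K ((T ^^ k) \<omega>)) \<le> e * real n"
    proof (intro exI allI)
      fix n
      show "(\<Sum>k<n. g K ((T ^^ k) \<omega>)) \<le> e * real n"
      proof (cases "n = 0")
        case False
        then have "(\<Sum>k<n. g K ((T ^^ k) \<omega>)) < inverse (real (Suc j)) * real n" using K by auto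
        also have "\<dots> \<le> e * real n" using j by (intro mult_right_mono) auto
        finally show ?thesis by simp
      qed simp
    qed
  qed
qed

end

section \<open>Walks over a measure-preserving map\<close>

lemma finite_SUP_attained:
  fixes f :: "'i \<Rightarrow> 'b :: complete_linorder"
  assumes "finite J" "J \<noteq> {}"
  obtains j where "j \<in> J" "(SUP j\<in>J. f j) = f j"
proof -
  have "(SUP j\<in>J. f j) = Max (f ` J)" using assms by (intro Max_Sup[symmetric]) auto
  then have "(SUP j\<in>J. f j) \<in> f ` J" using assms by simp
  then show thesis using that by auto
qed

definition walk_weight ::
    "('w \<Rightarrow> 'w) \<Rightarrow> ('w \<Rightarrow> 'i \<Rightarrow> 'i \<Rightarrow> ereal) \<Rightarrow> 'w \<Rightarrow> (nat \<Rightarrow> 'i) \<Rightarrow> nat \<Rightarrow> ereal" where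
  "walk_weight T a \<omega> p n = (\<Sum>k<n. a ((T ^^ k) \<omega>) (p k) (p (Suc k)))"

text \<open>Splitting off the first step makes measurability in \<open>\<omega>\<close> an
  induction. \<open>max_walk_le_iff\<close> identifies the value with the maximum of
  \<open>walk_weight\<close> over all walks from \<open>i\<close>.\<close>

primrec max_walk ::
    "('w \<Rightarrow> 'w) \<Rightarrow> ('w \<Rightarrow> 'i \<Rightarrow> 'i \<Rightarrow> ereal) \<Rightarrow> nat \<Rightarrow> 'w \<Rightarrow> 'i \<Rightarrow> ereal" where
  "max_walk T a 0 \<omega> i = 0"
| "max_walk T a (Suc n) \<omega> i = (SUP j. a \<omega> i j + max_walk T a n (T \<omega>) j)"

text \<open>A forbidden step gets weight \<open>-\<infinity>\<close> instead of being removed. The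
  node set is unchanged and the weights remain dominated by \<open>g\<close>, so results on walk
  systems apply to the restricted weights.\<close>

definition restrict_steps ::
    "('i \<Rightarrow> 'i \<Rightarrow> bool) \<Rightarrow> ('w \<Rightarrow> 'i \<Rightarrow> 'i \<Rightarrow> ereal) \<Rightarrow> 'w \<Rightarrow> 'i \<Rightarrow> 'i \<Rightarrow> ereal" where
  "restrict_steps R a \<omega> i j = (if R i j then a \<omega> i j else -\<infinity>)"

lemma walk_weight_add:
  "walk_weight T a \<omega> p (k + m) =
    walk_weight T a \<omega> p k + walk_weight T a ((T ^^ k) \<omega>) (\<lambda>l. p (k + l)) m"
  by (induction m) (auto simp: walk_weight_def add.assoc funpow_add add.commute[of k] o_def)

lemma walk_weight_Suc:
  "walk_weight T a \<omega> p (Suc n) = a \<omega> (p 0) (p 1) + walk_weight T a (T \<omega>) (\<lambda>k. p (Suc k)) n"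
  using walk_weight_add[of T a \<omega> p 1 n] by (simp add: walk_weight_def)

lemma walk_weight_le: "walk_weight T a \<omega> p n \<le> max_walk T a n \<omega> (p 0)"
proof (induction n arbitrary: \<omega> p)
  case (Suc n)
  have "walk_weight T a \<omega> p (Suc n) \<le> a \<omega> (p 0) (p 1) + max_walk T a n (T \<omega>) (p 1)"
    unfolding walk_weight_Suc using Suc[of "T \<omega>" "\<lambda>k. p (Suc k)"] by (simp add: add_left_mono)
  also have "\<dots> \<le> max_walk T a (Suc n) \<omega> (p 0)" by (auto intro: SUP_upper)
  finally show ?case .
qed (simp add: walk_weight_def)

lemma walk_weight_attained:
  fixes a :: "'w \<Rightarrow> 'i :: finite \<Rightarrow> 'i \<Rightarrow> ereal"
  obtains p where "p 0 = i" "walk_weight T a \<omega> p n = max_walk T a n \<omega> i"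
proof -
  have "\<exists>p. p 0 = i \<and> walk_weight T a \<omega> p n = max_walk T a n \<omega> i"
  proof (induction n arbitrary: \<omega> i)
    case (Suc n)
    obtain j where j: "max_walk T a (Suc n) \<omega> i = a \<omega> i j + max_walk T a n (T \<omega>) j"
      using finite_SUP_attained[of UNIV "\<lambda>j. a \<omega> i j + max_walk T a n (T \<omega>) j"] by auto
    obtain p where "p 0 = j" "walk_weight T a (T \<omega>) p n = max_walk T a n (T \<omega>) j"
      using Suc by blast
    then show ?case
      using j by (intro exI[of _ "case_nat i p"]) (simp add: walk_weight_Suc)
  qed (auto simp: walk_weight_def)
  then show thesis using that by blast
qed

lemma max_walk_le_iff:
  fixes a :: "'w \<Rightarrow> 'i :: finite \<Rightarrow> 'i \<Rightarrow> ereal"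
  shows "max_walk T a n \<omega> i \<le> c \<longleftrightarrow> (\<forall>p. p 0 = i \<longrightarrow> walk_weight T a \<omega> p n \<le> c)"
  by (metis order_trans walk_weight_attained walk_weight_le)

text \<open>Follow \<open>p\<close> for \<open>k\<close> steps and then an optimal walk of length
  \<open>m\<close>.\<close>

lemma max_walk_add_ge:
  fixes a :: "'w \<Rightarrow> 'i :: finite \<Rightarrow> 'i \<Rightarrow> ereal"
  shows "walk_weight T a \<omega> p k + max_walk T a m ((T ^^ k) \<omega>) (p k) \<le> max_walk T a (k + m) \<omega> (p 0)"
proof -
  obtain q where q: "q 0 = p k" "walk_weight T a ((T ^^ k) \<omega>) q m = max_walk T a m ((T ^^ k) \<omega>) (p k)"
    by (rule walk_weight_attained)
  define r where "r l = (if l \<le> k then p l else q (l - k))" for l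
  have "walk_weight T a \<omega> r k = walk_weight T a \<omega> p k"
    by (auto simp: walk_weight_def r_def)
  moreover have "(\<lambda>l. r (k + l)) = q" using q(1) by (auto simp: r_def)
  ultimately have "walk_weight T a \<omega> r (k + m) = walk_weight T a \<omega> p k + walk_weight T a ((T ^^ k) \<omega>) q m"
    by (simp add: walk_weight_add)
  moreover have "r 0 = p 0" by (simp add: r_def)
  ultimately show ?thesis using walk_weight_le[of T a \<omega> r "k + m"] q(2) by simp
qed

text \<open>The weights are dominated by one integrable function from above only; weights
  \<open>-\<infinity>\<close> are allowed and stand for absent steps.\<close>

locale walk_system = measure_preserving_system M T for M :: "'w measure" and T :: "'w \<Rightarrow> 'w" +
  fixes a :: "'w \<Rightarrow> 'i :: finite \<Rightarrow> 'i \<Rightarrow> ereal" and g :: "'w \<Rightarrow> real"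
  assumes a_measurable [measurable]: "\<And>i j. (\<lambda>\<omega>. a \<omega> i j) \<in> borel_measurable M"
    and g_integrable: "integrable M g"
    and g_nonneg: "\<And>\<omega>. 0 \<le> g \<omega>"
    and a_le_g: "AE \<omega> in M. \<forall>i j. a \<omega> i j \<le> ereal (g \<omega>)"
begin

lemma max_walk_measurable [measurable]: "(\<lambda>\<omega>. max_walk T a n \<omega> i) \<in> borel_measurable M"
proof (induction n arbitrary: i)
  case (Suc n)
  note [measurable] = Suc
  show ?case by simp
qed simp

lemma walk_system_restrict: "walk_system M T (restrict_steps R a) g"
  by unfold_locales (use g_integrable g_nonneg a_le_g in \<open>auto simp: restrict_steps_def\<close>)

text \<open>
  Losing is tested only on walks with steps in \<open>R\<close>; each of the at most \<open>D\<close> other steps spoils a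
  bounded window of starting times.
\<close>
lemma AE_walk_bound:
  fixes b :: real
  shows "AE \<omega> in M. \<forall>D. \<forall>e>0. \<exists>n0. \<forall>n\<ge>n0. \<forall>p.
    (\<forall>k<n. \<exists>m\<ge>1. max_walk T (restrict_steps R a) m ((T ^^ k) \<omega>) (p k) \<le> ereal (b * real m)) \<longrightarrow>
    card {k. k < n \<and> \<not> R (p k) (p (Suc k))} \<le> D \<longrightarrow>
    walk_weight T a \<omega> p n \<le> ereal ((b + e) * real n)"
proof -
  interpret R: walk_system M T "restrict_steps R a" g by (rule walk_system_restrict)
  note [measurable] = R.max_walk_measurable
  have [measurable]: "g \<in> borel_measurable M" using g_integrable by auto
  define L where "L m \<omega> j \<longleftrightarrow> max_walk T (restrict_steps R a) m \<omega> j \<le> ereal (b * real m)" for m \<omega> j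
  \<comment> \<open>Whatever the sign of \<open>b\<close>, \<open>b + h\<close> is at least
    \<open>g\<close>, so \<open>h\<close> is a nonnegative integrable bound for the excess of one
    step over \<open>b\<close>.\<close>
  define h where "h \<omega> = g \<omega> + \<bar>b\<bar>" for \<omega>
  have h_int: "integrable M h" unfolding h_def using g_integrable by auto
  have h_nn: "0 \<le> h \<omega>" for \<omega> using g_nonneg by (simp add: h_def)
  \<comment> \<open>\<open>bad K\<close> decreases to the empty set, so its contribution to \<open>h\<close> has small averages for large \<open>K\<close>.\<close>
  define bad where "bad K = {\<omega> \<in> space M. \<exists>j. (\<exists>m\<ge>1. L m \<omega> j) \<and> \<not> (\<exists>m\<in>{1..K}. L m \<omega> j)}" for K
  have [measurable]: "bad K \<in> sets M" for K unfolding bad_def L_def by measurable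
  have not_bad: "eventually (\<lambda>K. \<omega> \<notin> bad K) sequentially" for \<omega>
  proof (rule eventually_sequentiallyI)
    \<comment> \<open>\<open>f j\<close> is a length that shows \<open>j\<close> to be losing; as
      there are finitely many nodes, their maximum serves all of them.\<close>
    define f where "f j = (SOME m. 1 \<le> m \<and> L m \<omega> j)" for j
    have f: "1 \<le> f j \<and> L (f j) \<omega> j" if "\<exists>m\<ge>1. L m \<omega> j" for j
      unfolding f_def by (rule someI_ex) (rule that)
    show "\<omega> \<notin> bad K" if "Max (range f) \<le> K" for K
    proof
      assume "\<omega> \<in> bad K"
      then obtain j where j: "\<exists>m\<ge>1. L m \<omega> j" "\<not> (\<exists>m\<in>{1..K}. L m \<omega> j)" unfolding bad_def by blast
      have "f j \<le> Max (range f)" by simp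
      then show False using f[OF j(1)] j(2) that by auto
    qed
  qed
  have lim0: "(\<lambda>K. h \<omega> * indicator (bad K) \<omega>) \<longlonglongrightarrow> 0" for \<omega>
  proof (rule tendsto_eventually)
    show "eventually (\<lambda>K. h \<omega> * indicator (bad K) \<omega> = 0) sequentially"
      using not_bad[of \<omega>] by eventually_elim simp
  qed
  have AE1: "AE \<omega> in M. \<forall>e>0. \<exists>K. \<forall>n. (\<Sum>k<n. (\<lambda>\<omega>. h \<omega> * indicator (bad K) \<omega>) ((T ^^ k) \<omega>)) \<le> e * real n"
  proof (rule AE_small_averages)
    show "integrable M (\<lambda>\<omega>. h \<omega> * indicator (bad K) \<omega>)" for K
      using h_int by (intro integrable_real_mult_indicator) auto
    have "(\<lambda>K. \<integral>\<omega>. h \<omega> * indicator (bad K) \<omega> \<partial>M) \<longlonglongrightarrow> (\<integral>\<omega>. 0 \<partial>M)"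
    proof (rule integral_dominated_convergence[where w = h])
      show "AE \<omega> in M. (\<lambda>K. h \<omega> * indicator (bad K) \<omega>) \<longlonglongrightarrow> 0"
        by (intro AE_I2 lim0)
      have [measurable]: "h \<in> borel_measurable M" using h_int by auto
      show "\<And>K. (\<lambda>\<omega>. h \<omega> * indicator (bad K) \<omega>) \<in> borel_measurable M" by measurable
      show "AE \<omega> in M. norm (h \<omega> * indicator (bad K) \<omega>) \<le> h \<omega>" for K
        using h_nn by (intro AE_I2) (auto simp: indicator_def)
    qed (use h_int in auto)
    then show "(\<lambda>K. \<integral>\<omega>. h \<omega> * indicator (bad K) \<omega> \<partial>M) \<longlonglongrightarrow> 0" by simp
  qed (simp add: h_nn)
  \<comment> \<open>This bounds a single value of \<open>h\<close> before time \<open>n\<close> by a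
    constant plus a small multiple of \<open>n\<close>. It controls the boundedly many spoiled
    times, at which losing pieces cannot be used.\<close>
  have AE2: "AE \<omega> in M. \<forall>e>0. \<exists>K. \<forall>n. (\<Sum>k<n. (\<lambda>\<omega>. max 0 (h \<omega> - real K)) ((T ^^ k) \<omega>)) \<le> e * real n"
  proof (rule AE_small_averages)
    show "integrable M (\<lambda>\<omega>. max 0 (h \<omega> - real K))" for K
      using h_int by (intro integrable_max Bochner_Integration.integrable_diff) auto
    have "(\<lambda>K. \<integral>\<omega>. max 0 (h \<omega> - real K) \<partial>M) \<longlonglongrightarrow> (\<integral>\<omega>. 0 \<partial>M)"
    proof (rule integral_dominated_convergence[where w = h])
      show "AE \<omega> in M. (\<lambda>K. max 0 (h \<omega> - real K)) \<longlonglongrightarrow> 0"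
      proof (rule AE_I2)
        fix \<omega>
        have "eventually (\<lambda>K. max 0 (h \<omega> - real K) = 0) sequentially"
          using eventually_ge_at_top[of "nat \<lceil>h \<omega>\<rceil>"]
        proof eventually_elim
          case (elim K)
          then have "h \<omega> \<le> real K" by linarith
          then show ?case by simp
        qed
        then show "(\<lambda>K. max 0 (h \<omega> - real K)) \<longlonglongrightarrow> 0" by (rule tendsto_eventually)
      qed
      have [measurable]: "h \<in> borel_measurable M" using h_int by auto
      show "(\<lambda>\<omega>. max 0 (h \<omega> - real K)) \<in> borel_measurable M" for K by measurable
      show "AE \<omega> in M. norm (max 0 (h \<omega> - real K)) \<le> h \<omega>" for K
        using h_nn by (intro AE_I2) auto
    qed (use h_int in auto)
    then show "(\<lambda>K. \<integral>\<omega>. max 0 (h \<omega> - real K) \<partial>M) \<longlonglongrightarrow> 0" by simp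
  qed simp
  have AE3: "AE \<omega> in M. \<forall>k. \<forall>i j. a ((T ^^ k) \<omega>) i j \<le> ereal (g ((T ^^ k) \<omega>))"
    by (rule AE_funpow_T[OF a_le_g])
  show ?thesis
    using AE1 AE2 AE3 AE_space
  proof eventually_elim
    case (elim \<omega>)
    show ?case
    proof (intro allI impI)
      fix D :: nat and e :: real assume e: "0 < e"
      then obtain K where K: "\<And>n. (\<Sum>k<n. h ((T ^^ k) \<omega>) * indicator (bad K) ((T ^^ k) \<omega>)) \<le> e/2 * real n"
        using elim(1)[rule_format, of "e/2"] by auto
      \<comment> \<open>\<open>C\<close> will bound the number of spoiled times: a window of
        \<open>K\<close> times for each of at most \<open>D\<close> exceptional steps, and the last
        \<open>K\<close> times.\<close>
      define C where "C = real (D * K + K)"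
      have C: "0 \<le> C" by (simp add: C_def)
      obtain K' where K': "\<And>n. (\<Sum>k<n. max 0 (h ((T ^^ k) \<omega>) - real K')) \<le> e / (4 * (C + 1)) * real n"
        using elim(2)[rule_format, of "e / (4 * (C + 1))"] e C by auto
      have h_le: "h ((T ^^ k) \<omega>) \<le> real K' + e / (4 * (C + 1)) * real n" if "k < n" for k n
      proof -
        have "h ((T ^^ k) \<omega>) - real K' \<le> max 0 (h ((T ^^ k) \<omega>) - real K')" by simp
        also have "\<dots> \<le> (\<Sum>k<n. max 0 (h ((T ^^ k) \<omega>) - real K'))"
          using that by (intro member_le_sum) auto
        also note K'[of n]
        finally show ?thesis by simp
      qed
      show "\<exists>n0. \<forall>n\<ge>n0. \<forall>p.
        (\<forall>k<n. \<exists>m\<ge>1. max_walk T (restrict_steps R a) m ((T ^^ k) \<omega>) (p k) \<le> ereal (b * real m)) \<longrightarrow>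
        card {k. k < n \<and> \<not> R (p k) (p (Suc k))} \<le> D \<longrightarrow>
        walk_weight T a \<omega> p n \<le> ereal ((b + e) * real n)"
      proof (intro exI[of _ "nat \<lceil>4 * C * real K' / e\<rceil>"] allI impI)
        fix n p
        assume n: "nat \<lceil>4 * C * real K' / e\<rceil> \<le> n"
          and losing: "\<forall>k<n. \<exists>m\<ge>1. max_walk T (restrict_steps R a) m ((T ^^ k) \<omega>) (p k) \<le> ereal (b * real m)"
          and card: "card {k. k < n \<and> \<not> R (p k) (p (Suc k))} \<le> D"
        define X where "X = {k. k < n \<and> \<not> R (p k) (p (Suc k))}"
        \<comment> \<open>A piece of length at most \<open>K\<close> that starts at \<open>k\<close>
          contains step \<open>i\<close> only if \<open>k\<close> lies between
          \<open>Suc i - K\<close> and \<open>i\<close>, and overruns \<open>n\<close> only if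
          \<open>k\<close> is among the last \<open>K\<close> times.\<close>
        define Y where "Y = (\<Union>i\<in>X. {Suc i - K..i}) \<union> {n - K..<n}"
        have "finite X" by (simp add: X_def)
        have Y_fin: "finite Y" using \<open>finite X\<close> by (simp add: Y_def)
        have "card Y \<le> (\<Sum>i\<in>X. card {Suc i - K..i}) + card {n - K..<n}"
          unfolding Y_def using card_UN_le[OF \<open>finite X\<close>, of "\<lambda>i. {Suc i - K..i}"]
          by (intro order_trans[OF card_Un_le]) simp
        also have "\<dots> \<le> (\<Sum>i\<in>X. K) + K" by (intro add_mono sum_mono) auto
        also have "\<dots> \<le> D * K + K" using card by (simp add: X_def)
        finally have card_Y: "real (card Y) \<le> C" unfolding C_def of_nat_le_iff .
        let ?w = "\<lambda>k. a ((T ^^ k) \<omega>) (p k) (p (Suc k))"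
        let ?h = "\<lambda>k. h ((T ^^ k) \<omega>)"
        let ?S = "{k. (T ^^ k) \<omega> \<in> bad K} \<union> Y"
        have "sum ?w {0..<n} \<le> ereal (b * real (n - 0) + sum ?h ({0..<n} \<inter> ?S))"
        proof (rule covering_bound)
          fix k assume "k < n"
          have "?w k \<le> ereal (g ((T ^^ k) \<omega>))" using elim(3) by blast
          also have "\<dots> \<le> ereal (b + ?h k)" by (simp add: h_def)
          finally show "?w k \<le> ereal (b + ?h k)" .
          assume "k \<notin> ?S"
          then have "(T ^^ k) \<omega> \<notin> bad K" "k \<notin> Y" by auto
          moreover have "(T ^^ k) \<omega> \<in> space M" using elim(4) by (rule funpow_T_in_space)
          ultimately obtain m where m: "m \<in> {1..K}" "L m ((T ^^ k) \<omega>) (p k)"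
            using losing[rule_format, OF \<open>k < n\<close>] unfolding bad_def L_def by blast
          have km: "k + m \<le> n" using \<open>k \<notin> Y\<close> \<open>k < n\<close> m(1) by (auto simp: Y_def)
          have R: "R (p i) (p (Suc i))" if "k \<le> i" "i < k + m" for i
          proof (rule ccontr)
            assume "\<not> ?thesis"
            then have "i \<in> X" using that km by (simp add: X_def)
            moreover have "k \<in> {Suc i - K..i}" using that m(1) by auto
            ultimately show False using \<open>k \<notin> Y\<close> by (auto simp: Y_def)
          qed
          have "sum ?w {k..<k+m} = (\<Sum>i<m. ?w (i + k))"
            using sum.shift_bounds_nat_ivl[of ?w 0 k m] by (simp add: add.commute lessThan_atLeast0)
          also have "\<dots> = walk_weight T (restrict_steps R a) ((T ^^ k) \<omega>) (\<lambda>l. p (k + l)) m"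
            unfolding walk_weight_def
            by (intro sum.cong refl) (auto simp: restrict_steps_def R funpow_add add.commute)
          also have "\<dots> \<le> max_walk T (restrict_steps R a) m ((T ^^ k) \<omega>) (p (k + 0))"
            by (rule walk_weight_le)
          also have "\<dots> \<le> ereal (b * real m)" using m(2) by (simp add: L_def)
          finally show "\<exists>m\<ge>1. k + m \<le> n \<and> sum ?w {k..<k+m} \<le> ereal (b * real m)"
            using km m(1) by auto
        qed (simp_all add: h_nn)
        \<comment> \<open>The allowance \<open>e n\<close> is shared out: half for the times in
          \<open>bad K\<close>, a quarter for the constant \<open>C K'\<close>, by the choice of the
          lower bound on \<open>n\<close>, and a quarter for the part linear in \<open>n\<close>,
          since \<open>C / (C + 1) \<le> 1\<close>.\<close>
        also have "sum ?h ({0..<n} \<inter> ?S) \<le> e * real n"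
        proof -
          have "sum ?h ({0..<n} \<inter> ?S) = sum ?h ({k\<in>{0..<n}. (T ^^ k) \<omega> \<in> bad K} \<union> ({0..<n} \<inter> Y))"
            by (intro arg_cong2[where f = sum]) auto
          also have "\<dots> \<le> sum ?h {k\<in>{0..<n}. (T ^^ k) \<omega> \<in> bad K} + sum ?h ({0..<n} \<inter> Y)"
            using sum.union_inter[of "{k\<in>{0..<n}. (T ^^ k) \<omega> \<in> bad K}" "{0..<n} \<inter> Y" ?h]
              sum_nonneg[of "{k\<in>{0..<n}. (T ^^ k) \<omega> \<in> bad K} \<inter> ({0..<n} \<inter> Y)" ?h] h_nn by simp
          also have "sum ?h {k\<in>{0..<n}. (T ^^ k) \<omega> \<in> bad K} = (\<Sum>k<n. ?h k * indicator (bad K) ((T ^^ k) \<omega>))"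
            by (simp add: indicator_def sum.If_cases if_distrib lessThan_atLeast0 Int_def cong: if_cong)
          also have "\<dots> \<le> e/2 * real n" by (rule K)
          also have "sum ?h ({0..<n} \<inter> Y) \<le> (\<Sum>k\<in>{0..<n} \<inter> Y. real K' + e / (4 * (C + 1)) * real n)"
            by (intro sum_mono h_le) auto
          also have "\<dots> \<le> C * (real K' + e / (4 * (C + 1)) * real n)"
          proof -
            have "real (card ({0..<n} \<inter> Y)) \<le> C"
              using card_Y card_mono[OF Y_fin, of "{0..<n} \<inter> Y"] by simp
            then show ?thesis using e C by (simp add: mult_right_mono)
          qed
          also have "\<dots> = C * real K' + C / (C + 1) * (e / 4 * real n)" by (simp add: field_simps)
          also have "C * real K' \<le> e / 4 * real n"
          proof -
            have "4 * C * real K' / e \<le> real n" using n by linarith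
            then show ?thesis using e by (simp add: field_simps)
          qed
          also have "C / (C + 1) * (e / 4 * real n) \<le> 1 * (e / 4 * real n)"
            using C e by (intro mult_right_mono) auto
          finally show ?thesis by simp
        qed
        finally show "walk_weight T a \<omega> p n \<le> ereal ((b + e) * real n)"
          by (simp add: walk_weight_def lessThan_atLeast0 algebra_simps)
      qed
    qed
  qed
qed


text \<open>The integrals of \<open>g / (K + 1)\<close> tend to 0, so
  \<open>AE_small_averages\<close> with \<open>e = 1\<close> gives a random \<open>K\<close> for
  which the sums of \<open>g\<close> along the orbit are at most \<open>(K + 1) n\<close>.\<close>

lemma AE_max_walk_le_linear:
  "AE \<omega> in M. \<exists>K::nat. \<forall>n i. max_walk T a n \<omega> i \<le> ereal (real K * real n)"
proof -
  have "AE \<omega> in M. \<forall>e>0. \<exists>K. \<forall>n. (\<Sum>k<n. (\<lambda>\<omega>. g \<omega> / real (Suc K)) ((T ^^ k) \<omega>)) \<le> e * real n"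
  proof (rule AE_small_averages)
    have "(\<lambda>K. (\<integral>\<omega>. g \<omega> \<partial>M) * (1 / real (Suc K))) \<longlonglongrightarrow> (\<integral>\<omega>. g \<omega> \<partial>M) * 0"
      using lim_1_over_n[where 'a=real] by (intro tendsto_mult tendsto_const LIMSEQ_Suc)
    then show "(\<lambda>K. \<integral>\<omega>. g \<omega> / real (Suc K) \<partial>M) \<longlonglongrightarrow> 0"
      by simp
  qed (use g_integrable g_nonneg in auto)
  with AE_funpow_T[OF a_le_g] show ?thesis
  proof eventually_elim
    case (elim \<omega>)
    obtain K where K: "\<And>n. (\<Sum>k<n. g ((T ^^ k) \<omega>) / real (Suc K)) \<le> real n"
      using elim(2)[rule_format, of 1] by auto
    show ?case
    proof (intro exI[of _ "Suc K"] allI)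
      fix n i
      have "walk_weight T a \<omega> p n \<le> ereal (real (Suc K) * real n)" for p
      proof -
        have "walk_weight T a \<omega> p n \<le> (\<Sum>k<n. ereal (g ((T ^^ k) \<omega>)))"
          unfolding walk_weight_def using elim(1) by (intro sum_mono) blast
        also have "\<dots> = ereal (real (Suc K) * (\<Sum>k<n. g ((T ^^ k) \<omega>) / real (Suc K)))"
          by (simp add: sum_distrib_left)
        also have "\<dots> \<le> ereal (real (Suc K) * real n)"
          unfolding ereal_less_eq by (intro mult_left_mono K) simp
        finally show ?thesis .
      qed
      then show "max_walk T a n \<omega> i \<le> ereal (real (Suc K) * real n)"
        unfolding max_walk_le_iff by blast
    qed
  qed
qed

text \<open>Otherwise some rational \<open>b\<close> lies strictly between the lower and the upper
  limit. If all states reached from \<open>i\<close> with finite weight are losing at rate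
  \<open>b\<close>, then \<open>AE_walk_bound\<close> pushes the upper limit down to
  \<open>b1\<close>, which was chosen below it. If one of them is not losing, walks through it push
  the lower limit up to \<open>b0\<close>, which was chosen above it.\<close>

lemma AE_max_walk_converges:
  "AE \<omega> in M. \<forall>i. \<exists>l. l \<noteq> \<infinity> \<and> (\<lambda>n. max_walk T a n \<omega> i / ereal (real n)) \<longlonglongrightarrow> l"
proof -
  \<comment> \<open>With every step allowed, the restricted weights are the original ones and there
    are no exceptional steps, so \<open>D = 0\<close> suffices.\<close>
  have eq: "restrict_steps (\<lambda>_ _. True) a = a" by (intro ext) (simp add: restrict_steps_def)
  have "AE \<omega> in M. \<forall>b::rat. \<forall>D. \<forall>e>0. \<exists>n0. \<forall>n\<ge>n0. \<forall>p.
    (\<forall>k<n. \<exists>m\<ge>1. max_walk T a m ((T ^^ k) \<omega>) (p k) \<le> ereal (real_of_rat b * real m)) \<longrightarrow>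
    card {k. k < n \<and> \<not> True} \<le> D \<longrightarrow>
    walk_weight T a \<omega> p n \<le> ereal ((real_of_rat b + e) * real n)"
  proof (subst AE_all_countable, rule allI)
    fix b :: rat
    show "AE \<omega> in M. \<forall>D. \<forall>e>0. \<exists>n0. \<forall>n\<ge>n0. \<forall>p.
      (\<forall>k<n. \<exists>m\<ge>1. max_walk T a m ((T ^^ k) \<omega>) (p k) \<le> ereal (real_of_rat b * real m)) \<longrightarrow>
      card {k. k < n \<and> \<not> True} \<le> D \<longrightarrow>
      walk_weight T a \<omega> p n \<le> ereal ((real_of_rat b + e) * real n)"
      using AE_walk_bound[of "\<lambda>_ _. True" "real_of_rat b"] unfolding eq .
  qed
  with AE_max_walk_le_linear show ?thesis
  proof eventually_elim
    case (elim \<omega>)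
    obtain K :: nat where K: "\<And>n i. max_walk T a n \<omega> i \<le> ereal (real K * real n)" using elim(1) by blast
    have w_fin: "walk_weight T a \<omega> p n \<noteq> \<infinity>" for p n
      using K[of n "p 0"] walk_weight_le[of T a \<omega> p n] by auto
    show ?case
    proof
      fix i
      define X where "X n = max_walk T a n \<omega> i / ereal (real n)" for n
      have le: "X n \<le> ereal c" if "max_walk T a n \<omega> i \<le> ereal (c * real n)" "0 < n" for c n
        unfolding X_def using that by (simp add: ereal_divide_le_pos mult.commute)
      have ge: "ereal c \<le> X n" if "ereal (c * real n) \<le> max_walk T a n \<omega> i" "0 < n" for c n
        unfolding X_def using that by (simp add: ereal_le_divide_pos mult.commute)
      have "limsup X \<le> liminf X"
      proof (rule ccontr)
        assume "\<not> ?thesis"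
        then have "liminf X < limsup X" by simp
        then obtain b :: rat where b: "liminf X < ereal (real_of_rat b)" "ereal (real_of_rat b) < limsup X"
          using ereal_dense3 by blast
        then obtain b0 b1 where b0: "liminf X < ereal b0" "b0 < real_of_rat b"
          and b1: "real_of_rat b < b1" "ereal b1 < limsup X"
          using ereal_dense2[OF b(1)] ereal_dense2[OF b(2)] by auto
        show False
        proof (cases "\<forall>p k. p 0 = i \<and> walk_weight T a \<omega> p k \<noteq> -\<infinity> \<longrightarrow>
            (\<exists>m\<ge>1. max_walk T a m ((T ^^ k) \<omega>) (p k) \<le> ereal (real_of_rat b * real m))")
          case True
          obtain n0 where n0: "\<And>n p. n \<ge> n0 \<Longrightarrow>
            (\<forall>k<n. \<exists>m\<ge>1. max_walk T a m ((T ^^ k) \<omega>) (p k) \<le> ereal (real_of_rat b * real m)) \<Longrightarrow>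
            walk_weight T a \<omega> p n \<le> ereal ((real_of_rat b + (b1 - real_of_rat b)) * real n)"
            using elim(2)[rule_format, of "b1 - real_of_rat b" b 0] b1 by auto
          have "max_walk T a n \<omega> i \<le> ereal (b1 * real n)" if n: "n \<ge> n0" for n
            unfolding max_walk_le_iff
          proof (intro allI impI)
            fix p :: "nat \<Rightarrow> 'i" assume p: "p 0 = i"
            show "walk_weight T a \<omega> p n \<le> ereal (b1 * real n)"
            proof (cases "walk_weight T a \<omega> p n = -\<infinity>")
              case False
              \<comment> \<open>No walk has weight \<open>\<infinity>\<close>, so a prefix of weight
                \<open>-\<infinity>\<close> would make the whole walk weigh
                \<open>-\<infinity>\<close>. Hence all states on a walk of finite weight are covered
                by the case assumption.\<close>
              have "walk_weight T a \<omega> p k \<noteq> -\<infinity>" if "k < n" for k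
              proof
                assume inf: "walk_weight T a \<omega> p k = -\<infinity>"
                have "walk_weight T a \<omega> p n = walk_weight T a \<omega> p k +
                    walk_weight T a ((T ^^ k) \<omega>) (\<lambda>l. p (k + l)) (n - k)"
                  using walk_weight_add[of T a \<omega> p k "n - k"] that by simp
                then show False using inf False w_fin[of p n]
                  by (cases "walk_weight T a ((T ^^ k) \<omega>) (\<lambda>l. p (k + l)) (n - k)") auto
              qed
              then show ?thesis using n0[OF n, of p] True p by simp
            qed simp
          qed
          then have "eventually (\<lambda>n. X n \<le> ereal b1) sequentially"
            by (intro eventually_sequentiallyI[of "max n0 1"] le) auto
          then have "limsup X \<le> ereal b1" by (rule Limsup_bounded)
          then show False using b1 by simp
        next
          case False
          then obtain p k where p: "p 0 = i" "walk_weight T a \<omega> p k \<noteq> -\<infinity>"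
            and surv: "\<And>m. m \<ge> 1 \<Longrightarrow> ereal (real_of_rat b * real m) < max_walk T a m ((T ^^ k) \<omega>) (p k)"
            by (metis not_le)
          obtain c where c: "walk_weight T a \<omega> p k = ereal c"
            using p(2) w_fin[of p k] by (cases "walk_weight T a \<omega> p k") auto
          have bound: "ereal (c + real_of_rat b * real m) \<le> max_walk T a (k + m) \<omega> i" if "m \<ge> 1" for m
          proof -
            have "ereal (c + real_of_rat b * real m) \<le> walk_weight T a \<omega> p k + max_walk T a m ((T ^^ k) \<omega>) (p k)"
              unfolding c plus_ereal.simps(1)[symmetric] using surv[OF that] by (intro add_left_mono) simp
            also have "\<dots> \<le> max_walk T a (k + m) \<omega> i" using max_walk_add_ge[of T a \<omega> p k m] p by simp
            finally show ?thesis .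
          qed
          \<comment> \<open>The state is reached once, at the finite weight \<open>c\<close> and
            after \<open>k\<close> steps; for large \<open>n\<close> the gap between
            \<open>b0\<close> and \<open>b\<close> makes up for both.\<close>
          have "ereal b0 \<le> X n" if n: "n \<ge> Suc k" "n \<ge> nat \<lceil>(real_of_rat b * real k - c) / (real_of_rat b - b0)\<rceil>" for n
          proof (rule ge)
            have "(real_of_rat b * real k - c) / (real_of_rat b - b0) \<le> real n" using n(2) by linarith
            then have "real_of_rat b * real k - c \<le> (real_of_rat b - b0) * real n"
              using b0(2) by (simp add: field_simps)
            then have "b0 * real n \<le> c + real_of_rat b * real (n - k)"
              using n(1) by (simp add: of_nat_diff algebra_simps)
            then have "ereal (b0 * real n) \<le> ereal (c + real_of_rat b * real (n - k))" by simp
            also have "\<dots> \<le> max_walk T a n \<omega> i" using bound[of "n - k"] n(1) by simp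
            finally show "ereal (b0 * real n) \<le> max_walk T a n \<omega> i" .
          qed (use n in simp)
          then have "eventually (\<lambda>n. ereal b0 \<le> X n) sequentially"
            by (intro eventually_sequentiallyI[of "max (Suc k) (nat \<lceil>(real_of_rat b * real k - c) / (real_of_rat b - b0)\<rceil>)"]) auto
          then have "ereal b0 \<le> liminf X" by (rule Liminf_bounded)
          then show False using b0 by simp
        qed
      qed
      moreover have "liminf X \<le> limsup X" by (rule Liminf_le_Limsup) simp
      ultimately have eq: "liminf X = limsup X" by (rule antisym[rotated])
      have "eventually (\<lambda>n. X n \<le> ereal (real K)) sequentially"
        by (intro eventually_sequentiallyI[of 1] le K) simp
      then have "limsup X \<le> ereal (real K)" by (rule Limsup_bounded)
      then have "limsup X \<noteq> \<infinity>" by auto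
      moreover have "X \<longlonglongrightarrow> limsup X"
        using eq by (intro Liminf_eq_Limsup) simp_all
      ultimately show "\<exists>l. l \<noteq> \<infinity> \<and> (\<lambda>n. max_walk T a n \<omega> i / ereal (real n)) \<longlonglongrightarrow> l"
        unfolding X_def by blast
    qed
  qed
qed

end

text \<open>The constant is the essential supremum, that is, the infimum of the real levels that
  bound \<open>f\<close> almost surely. Comparing \<open>f\<close> with rational levels only keeps
  the number of null sets countable.\<close>

lemma (in prob_space) AE_eq_constI:
  fixes f :: "'a \<Rightarrow> ereal"
  assumes "\<And>c::real. (AE x in M. f x \<le> ereal c) \<or> (AE x in M. \<not> f x \<le> ereal c)"
  obtains l where "AE x in M. f x = l"
proof -
  define l where "l = Inf {ereal c |c. AE x in M. f x \<le> ereal c}"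
  have "AE x in M. \<forall>q::rat. (l < ereal (real_of_rat q) \<longrightarrow> f x \<le> ereal (real_of_rat q)) \<and>
    (ereal (real_of_rat q) < l \<longrightarrow> ereal (real_of_rat q) < f x)"
    unfolding AE_all_countable
  proof
    fix q :: rat
    consider "l < ereal (real_of_rat q)" | "ereal (real_of_rat q) < l" | "l = ereal (real_of_rat q)"
      by fastforce
    then show "AE x in M. (l < ereal (real_of_rat q) \<longrightarrow> f x \<le> ereal (real_of_rat q)) \<and>
      (ereal (real_of_rat q) < l \<longrightarrow> ereal (real_of_rat q) < f x)"
    proof cases
      case 1
      then obtain c where c: "AE x in M. f x \<le> ereal c" "ereal c < ereal (real_of_rat q)"
        unfolding l_def Inf_less_iff by auto
      from c(1) show ?thesis
        by eventually_elim (use 1 c(2) in \<open>auto intro: order_trans[OF _ less_imp_le]\<close>)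
    next
      case 2
      have "\<not> (AE x in M. f x \<le> ereal (real_of_rat q))"
      proof
        assume "AE x in M. f x \<le> ereal (real_of_rat q)"
        then have "l \<le> ereal (real_of_rat q)" unfolding l_def by (intro Inf_lower) auto
        then show False using 2 by simp
      qed
      then have "AE x in M. \<not> f x \<le> ereal (real_of_rat q)" using assms by blast
      then show ?thesis by eventually_elim (use 2 in auto)
    qed simp
  qed
  then have "AE x in M. f x = l"
  proof eventually_elim
    case (elim x)
    show ?case
    proof (rule antisym; rule ccontr)
      assume "\<not> f x \<le> l"
      then obtain q where "l < ereal (real_of_rat q)" "ereal (real_of_rat q) < f x"
        using ereal_dense3[of l "f x"] by (auto simp: not_le)
      then show False using elim by (meson not_le)
    next
      assume "\<not> l \<le> f x"
      then obtain q where "f x < ereal (real_of_rat q)" "ereal (real_of_rat q) < l"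
        using ereal_dense3[of "f x" l] by (auto simp: not_le)
      then show False using elim by (meson not_le order.asym)
    qed
  qed
  then show thesis by (rule that)
qed

lemma tendsto_finite_SUP:
  fixes X :: "'i \<Rightarrow> 'x \<Rightarrow> ereal"
  assumes "finite J" "\<And>j. j \<in> J \<Longrightarrow> (X j \<longlongrightarrow> l j) F"
  shows "((\<lambda>x. SUP j\<in>J. X j x) \<longlongrightarrow> (SUP j\<in>J. l j)) F"
  using assms by (induction J rule: finite_induct) (auto simp: sup_max intro: tendsto_max)

lemma finite_SUP_ereal_divide:
  fixes f :: "'i \<Rightarrow> ereal"
  assumes "finite J" "J \<noteq> {}" "0 < n"
  shows "(SUP j\<in>J. f j) / ereal (real n) = (SUP j\<in>J. f j / ereal (real n))"
proof (rule antisym)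
  obtain j where "j \<in> J" "(SUP j\<in>J. f j) = f j" using finite_SUP_attained[OF assms(1,2)] by blast
  then show "(SUP j\<in>J. f j) / ereal (real n) \<le> (SUP j\<in>J. f j / ereal (real n))"
    by (auto intro: SUP_upper)
  show "(SUP j\<in>J. f j / ereal (real n)) \<le> (SUP j\<in>J. f j) / ereal (real n)"
    using assms(3) by (intro SUP_least ereal_divide_right_mono SUP_upper) auto
qed

section \<open>Max-plus products as walks\<close>

abbreviation paths :: "('t \<Rightarrow> 'b::topological_space) measure" where
  "paths \<equiv> \<Pi>\<^sub>M t\<in>UNIV. borel"

lemma entry_measurable [measurable]: "(\<lambda>X::ereal^'d^'d. X $ i $ j) \<in> borel_measurable borel"
  by (intro borel_measurable_continuous_onI continuous_intros)

lemma path_entry_measurable [measurable]: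
  "(\<lambda>u::'t \<Rightarrow> ereal^'d^'d. u t $ i $ j) \<in> borel_measurable paths"
  by measurable

lemma path_measurable:
  assumes "\<And>t. A t \<in> borel_measurable M"
  shows "(\<lambda>\<omega> t. A t \<omega>) \<in> measurable M paths"
  by (rule measurable_PiM_single') (use assms in auto)

lemma sets_path_law [simp, measurable_cong]: "sets (path_law M A) = sets paths"
  by (simp add: path_law_def)

lemma space_path_law [simp]: "space (path_law M A) = UNIV"
  by (simp add: path_law_def space_PiM)

lemma mp_prod_measurable:
  fixes S :: "nat \<Rightarrow> 'w \<Rightarrow> ereal^'d^'d"
  assumes "\<And>k i j. (\<lambda>\<omega>. S k \<omega> $ i $ j) \<in> borel_measurable M"
  shows "(\<lambda>\<omega>. mp_prod J (\<lambda>k. S k \<omega>) n $ i $ j) \<in> borel_measurable M"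
proof (induction n arbitrary: i j)
  case (Suc n)
  note [measurable] = Suc assms
  show ?case by (simp add: mp_mult_def) measurable
qed (simp add: mp_one_def)

text \<open>A function of a one-sided path. Both \<open>x(n,0)\<close> and \<open>y(n,0)\<close> are
  obtained from it by inserting random paths with the same law (\<open>x_seq_eq\<close>,
  \<open>y_seq_eq\<close>, \<open>distr_backward\<close>).\<close>

definition X_path :: "nat \<Rightarrow> (nat \<Rightarrow> ereal^'d^'d) \<Rightarrow> 'd \<Rightarrow> ereal" where
  "X_path n u i = mp_apply (mp_prod UNIV u n) 0 $ i"

lemma X_path_eq: "X_path n u i = (SUP j. mp_prod UNIV u n $ i $ j)"
  by (simp add: X_path_def mp_apply_def)

lemma X_path_measurable:
  fixes S :: "nat \<Rightarrow> 'w \<Rightarrow> ereal^'d^'d"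
  assumes "\<And>k i j. (\<lambda>\<omega>. S k \<omega> $ i $ j) \<in> borel_measurable M"
  shows "(\<lambda>\<omega>. X_path n (\<lambda>k. S k \<omega>) i) \<in> borel_measurable M"
proof -
  note [measurable] = mp_prod_measurable[of S, OF assms]
  show ?thesis unfolding X_path_eq by measurable
qed

definition top_entry :: "'d set \<Rightarrow> nat \<Rightarrow> (nat \<Rightarrow> ereal^'d^'d) \<Rightarrow> ereal" where
  "top_entry J n u = (SUP i\<in>J. SUP j\<in>J. mp_prod J u n $ i $ j)"

text \<open>
  A walk contributing to \<open>u (n-1) \<cdots> u 0\<close> starts with the latest matrix. Transposing the matrices
  reverses it into a walk driven by the forward shift.
\<close>
definition rev_weight :: "(nat \<Rightarrow> ereal^'d^'d) \<Rightarrow> (nat \<Rightarrow> 'd) \<Rightarrow> nat \<Rightarrow> ereal" where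
  "rev_weight u q n = (\<Sum>k<n. u (n - Suc k) $ q k $ q (Suc k))"

lemma rev_weight_Suc:
  "rev_weight u q (Suc n) = u n $ q 0 $ q 1 + rev_weight u (\<lambda>k. q (Suc k)) n"
  unfolding rev_weight_def by (subst sum.lessThan_Suc_shift) simp

lemma rev_weight_le_mp_prod:
  "(\<And>k. k \<le> n \<Longrightarrow> q k \<in> J) \<Longrightarrow> rev_weight u q n \<le> mp_prod J u n $ q 0 $ q n"
proof (induction n arbitrary: q)
  case (Suc n)
  have "rev_weight u q (Suc n) \<le> u n $ q 0 $ q 1 + mp_prod J u n $ q 1 $ q (Suc n)"
    unfolding rev_weight_Suc using Suc.IH[of "\<lambda>k. q (Suc k)"] Suc.prems by (auto intro: add_left_mono)
  also have "\<dots> \<le> mp_prod J u (Suc n) $ q 0 $ q (Suc n)"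
    using Suc.prems[of 1] by (auto simp: mp_mult_def intro: SUP_upper)
  finally show ?case .
qed (simp add: rev_weight_def mp_one_def)

text \<open>The value \<open>-\<infinity>\<close> is set apart because for \<open>n = 0\<close> no
  walk joins two different nodes. The exclusion of \<open>\<infinity>\<close> is carried along since
  \<open>-\<infinity> + \<infinity>\<close> is \<open>\<infinity>\<close> in
  \<open>ereal\<close>.\<close>

lemma mp_prod_attained:
  fixes u :: "nat \<Rightarrow> ereal^'d^'d"
  assumes "\<And>t i j. u t $ i $ j \<noteq> \<infinity>" "i \<in> J" "j \<in> J"
  shows "mp_prod J u n $ i $ j \<noteq> \<infinity> \<and>
    (mp_prod J u n $ i $ j = -\<infinity> \<or>
      (\<exists>q. q 0 = i \<and> q n = j \<and> (\<forall>k\<le>n. q k \<in> J) \<and> rev_weight u q n = mp_prod J u n $ i $ j))"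
  using \<open>i \<in> J\<close>
proof (induction n arbitrary: i)
  case 0
  show ?case
  proof (cases "i = j")
    case True
    then show ?thesis using 0 by (auto simp: mp_one_def rev_weight_def intro!: exI[of _ "\<lambda>_. i"])
  qed (auto simp: mp_one_def)
next
  case (Suc n)
  obtain k where k: "k \<in> J" "mp_prod J u (Suc n) $ i $ j = u n $ i $ k + mp_prod J u n $ k $ j"
    using finite_SUP_attained[of J "\<lambda>k. u n $ i $ k + mp_prod J u n $ k $ j"] Suc.prems
    by (auto simp: mp_mult_def)
  note IH = Suc.IH[OF k(1)]
  show ?case
  proof (intro conjI)
    show "mp_prod J u (Suc n) $ i $ j \<noteq> \<infinity>" using k(2) IH assms(1)[of n i k] by simp
    show "mp_prod J u (Suc n) $ i $ j = -\<infinity> \<or>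
      (\<exists>q. q 0 = i \<and> q (Suc n) = j \<and> (\<forall>k\<le>Suc n. q k \<in> J) \<and>
        rev_weight u q (Suc n) = mp_prod J u (Suc n) $ i $ j)"
    proof (cases "mp_prod J u n $ k $ j = -\<infinity>")
      case True
      then show ?thesis using k(2) assms(1)[of n i k] by simp
    next
      case False
      then obtain q where q: "q 0 = k" "q n = j" "\<forall>l\<le>n. q l \<in> J"
        "rev_weight u q n = mp_prod J u n $ k $ j" using IH by blast
      have "rev_weight u (case_nat i q) (Suc n) = mp_prod J u (Suc n) $ i $ j"
        unfolding rev_weight_Suc k(2) by (simp add: q)
      moreover have "\<forall>l\<le>Suc n. case_nat i q l \<in> J"
        using q(3) Suc.prems by (auto split: nat.split)
      ultimately show ?thesis using q(2) by (intro disjI2 exI[of _ "case_nat i q"]) simp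
    qed
  qed
qed

lemma rev_weight_le_X_path: "rev_weight u q n \<le> X_path n u (q 0)"
proof -
  have "rev_weight u q n \<le> mp_prod UNIV u n $ q 0 $ q n" by (rule rev_weight_le_mp_prod) simp
  also have "\<dots> \<le> X_path n u (q 0)" unfolding X_path_eq by (rule SUP_upper) simp
  finally show ?thesis .
qed

lemma X_path_attained:
  fixes u :: "nat \<Rightarrow> ereal^'d^'d"
  assumes "\<And>t i j. u t $ i $ j \<noteq> \<infinity>"
  obtains q where "q 0 = i" "rev_weight u q n = X_path n u i"
proof -
  obtain j where j: "X_path n u i = mp_prod UNIV u n $ i $ j"
    unfolding X_path_eq using finite_SUP_attained[of UNIV "\<lambda>j. mp_prod UNIV u n $ i $ j"] by auto
  consider "mp_prod UNIV u n $ i $ j = -\<infinity>" | q where "q 0 = i" "rev_weight u q n = X_path n u i"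
    using mp_prod_attained[of u i UNIV j n] assms unfolding j by auto
  then show thesis
  proof cases
    case 1
    then have "X_path n u i = -\<infinity>" by (simp add: j)
    \<comment> \<open>Any walk from \<open>i\<close> weighs at most \<open>X_path n u i\<close>, so
      if this is \<open>-\<infinity>\<close>, even the constant walk attains it.\<close>
    then have "rev_weight u (\<lambda>_. i) n = X_path n u i" using rev_weight_le_X_path[of u "\<lambda>_. i" n] by simp
    then show thesis by (intro that[of "\<lambda>_. i"]) simp
  qed (rule that)
qed

definition shift :: "('t::{plus,one} \<Rightarrow> 'b) \<Rightarrow> 't \<Rightarrow> 'b" where
  "shift u = (\<lambda>t. u (t + 1))"

lemma shift_measurable [measurable]: "shift \<in> measurable paths (paths :: ('t::{plus,one} \<Rightarrow> 'b::topological_space) measure)"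
  unfolding shift_def by (rule path_measurable) simp

lemma funpow_shift: "(shift ^^ k) u = (\<lambda>t::nat. u (t + k))"
  by (induction k arbitrary: u) (auto simp: shift_def)

definition transposed :: "(nat \<Rightarrow> ereal^'d^'d) \<Rightarrow> 'd \<Rightarrow> 'd \<Rightarrow> ereal" where
  "transposed u i j = u 0 $ j $ i"

text \<open>Summation in reverse order: the reversed walk starts at \<open>q n\<close>, and its step
  at time \<open>k\<close> uses the matrix \<open>u k\<close>.\<close>

lemma rev_weight_eq_walk_weight:
  "rev_weight u q n = walk_weight shift transposed u (\<lambda>k. q (n - k)) n"
proof -
  have "rev_weight u q n = (\<Sum>k<n. u (n - Suc (n - Suc k)) $ q (n - Suc k) $ q (Suc (n - Suc k)))"
    unfolding rev_weight_def by (rule sum.nat_diff_reindex[symmetric])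
  also have "\<dots> = walk_weight shift transposed u (\<lambda>k. q (n - k)) n"
    unfolding walk_weight_def transposed_def funpow_shift
    by (intro sum.cong refl) (simp add: Suc_diff_Suc)
  finally show ?thesis .
qed

lemma walk_weight_eq_rev_weight:
  "walk_weight shift transposed u p n = rev_weight u (\<lambda>k. p (n - k)) n"
  unfolding rev_weight_eq_walk_weight walk_weight_def by (intro sum.cong refl) simp

lemma walk_weight_restrict:
  assumes "\<And>k. k < n \<Longrightarrow> R (p k) (p (Suc k))"
  shows "walk_weight T (restrict_steps R a) \<omega> p n = walk_weight T a \<omega> p n"
  unfolding walk_weight_def by (intro sum.cong refl) (use assms in \<open>simp add: restrict_steps_def\<close>)

text \<open>A walk from \<open>J\<close> with all steps in \<open>R\<close> stays in
  \<open>J\<close>, and its reversal contributes to an entry of the product; any other walk weighs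
  \<open>-\<infinity>\<close>. The relation need not be \<open>J \<times> J\<close>: mutual
  reachability is used later, with \<open>J\<close> a component.\<close>

lemma max_walk_le_top_entry:
  fixes u :: "nat \<Rightarrow> ereal^'d^'d"
  assumes u: "\<And>t i j. u t $ i $ j \<noteq> \<infinity>"
    and R: "\<And>i j. R i j \<Longrightarrow> i \<in> J \<Longrightarrow> j \<in> J" and "i \<in> J"
  shows "max_walk shift (restrict_steps R transposed) n u i \<le> top_entry J n u"
  unfolding max_walk_le_iff
proof (intro allI impI)
  fix p :: "nat \<Rightarrow> 'd" assume p: "p 0 = i"
  show "walk_weight shift (restrict_steps R transposed) u p n \<le> top_entry J n u"
  proof (cases "\<forall>k<n. R (p k) (p (Suc k))")
    case True
    have J: "k \<le> n \<Longrightarrow> p k \<in> J" for k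
      by (induction k) (use True p \<open>i \<in> J\<close> R in \<open>auto simp: Suc_le_eq\<close>)
    have "walk_weight shift (restrict_steps R transposed) u p n = rev_weight u (\<lambda>k. p (n - k)) n"
      using True by (simp add: walk_weight_restrict walk_weight_eq_rev_weight)
    also have "\<dots> \<le> mp_prod J u n $ p n $ p 0"
      using rev_weight_le_mp_prod[of n "\<lambda>k. p (n - k)" J u] J by simp
    also have "\<dots> \<le> top_entry J n u"
      unfolding top_entry_def using J by (intro SUP_upper2[of "p n"] SUP_upper) auto
    finally show ?thesis .
  next
    case False
    then obtain k where k: "k < n" "\<not> R (p k) (p (Suc k))" by blast
    have "walk_weight shift (restrict_steps R transposed) u p n =
        restrict_steps R transposed ((shift ^^ k) u) (p k) (p (Suc k)) +
        (\<Sum>l\<in>{..<n} - {k}. restrict_steps R transposed ((shift ^^ l) u) (p l) (p (Suc l)))"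
      unfolding walk_weight_def using k(1) by (intro sum.remove) auto
    moreover have "(\<Sum>l\<in>{..<n} - {k}. restrict_steps R transposed ((shift ^^ l) u) (p l) (p (Suc l))) \<noteq> \<infinity>"
      using u by (simp add: sum_Pinfty restrict_steps_def transposed_def funpow_shift)
    ultimately have "walk_weight shift (restrict_steps R transposed) u p n = -\<infinity>"
      using k(2) by (simp add: restrict_steps_def[of R transposed "(shift ^^ k) u"])
    then show ?thesis by simp
  qed
qed

text \<open>Turns the numerator in \<open>lyapunov\<close> into a finite maximum of walk weights, to
  which \<open>AE_max_walk_converges\<close> applies. Because of the reversal, a walk starts at the
  column index of the entry.\<close>

lemma top_entry_eq_SUP_max_walk:
  fixes u :: "nat \<Rightarrow> ereal^'d^'d"
  assumes u: "\<And>t i j. u t $ i $ j \<noteq> \<infinity>"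
  shows "top_entry J n u = (SUP i\<in>J. max_walk shift (restrict_steps (\<lambda>i j. i \<in> J \<and> j \<in> J) transposed) n u i)"
proof (rule antisym)
  show "(SUP i\<in>J. max_walk shift (restrict_steps (\<lambda>i j. i \<in> J \<and> j \<in> J) transposed) n u i) \<le> top_entry J n u"
    by (intro SUP_least max_walk_le_top_entry u) auto
  show "top_entry J n u \<le> (SUP i\<in>J. max_walk shift (restrict_steps (\<lambda>i j. i \<in> J \<and> j \<in> J) transposed) n u i)"
    unfolding top_entry_def
  proof (intro SUP_least)
    fix i j assume ij: "i \<in> J" "j \<in> J"
    consider "mp_prod J u n $ i $ j = -\<infinity>" | q where "q 0 = i" "q n = j" "\<forall>k\<le>n. q k \<in> J"
        "rev_weight u q n = mp_prod J u n $ i $ j"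
      using mp_prod_attained[of u i J j n] u ij by blast
    then show "mp_prod J u n $ i $ j \<le> (SUP i\<in>J. max_walk shift (restrict_steps (\<lambda>i j. i \<in> J \<and> j \<in> J) transposed) n u i)"
    proof cases
      case 2
      have "mp_prod J u n $ i $ j = walk_weight shift (restrict_steps (\<lambda>i j. i \<in> J \<and> j \<in> J) transposed) u (\<lambda>k. q (n - k)) n"
        unfolding 2(4)[symmetric] rev_weight_eq_walk_weight
        by (rule walk_weight_restrict[symmetric]) (use 2(3) in auto)
      also have "\<dots> \<le> max_walk shift (restrict_steps (\<lambda>i j. i \<in> J \<and> j \<in> J) transposed) n u (q (n - 0))"
        by (rule walk_weight_le)
      also have "\<dots> \<le> (SUP i\<in>J. max_walk shift (restrict_steps (\<lambda>i j. i \<in> J \<and> j \<in> J) transposed) n u i)"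
        using 2 ij by (intro SUP_upper) auto
      finally show ?thesis .
    qed simp
  qed
qed

section \<open>Convergence in probability to a constant\<close>

text \<open>Probability tending to 1, phrased with measurable subsets, so that conjunctions and
  consequences can be formed without proving \<open>Q\<close> measurable.\<close>

definition whp :: "'a measure \<Rightarrow> (nat \<Rightarrow> 'a \<Rightarrow> bool) \<Rightarrow> bool" where
  "whp M Q \<longleftrightarrow> (\<forall>e>0. eventually (\<lambda>n. \<exists>S\<in>sets M. 1 - e \<le> measure M S \<and> (\<forall>x\<in>S. Q n x)) sequentially)"

text \<open>Convergence in probability to a constant in terms of real thresholds. It makes sense for
  \<open>l = -\<infinity>\<close>, where the first clause is void.\<close>

definition in_prob :: "'a measure \<Rightarrow> (nat \<Rightarrow> 'a \<Rightarrow> ereal) \<Rightarrow> ereal \<Rightarrow> bool" where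
  "in_prob M X l \<longleftrightarrow>
    (\<forall>b::real. ereal b < l \<longrightarrow> whp M (\<lambda>n x. ereal b < X n x)) \<and>
    (\<forall>b::real. l < ereal b \<longrightarrow> whp M (\<lambda>n x. X n x < ereal b))"

lemma whp_mono: "whp M Q \<Longrightarrow> (\<And>n x. Q n x \<Longrightarrow> Q' n x) \<Longrightarrow> whp M Q'"
  unfolding whp_def by (fast elim: eventually_mono)

context prob_space
begin

lemma whp_measurable_iff:
  assumes [measurable]: "\<And>n. Measurable.pred M (Q n)"
  shows "whp M Q \<longleftrightarrow> (\<forall>e>0. eventually (\<lambda>n. 1 - e \<le> prob {x \<in> space M. Q n x}) sequentially)"
proof -
  have "(\<exists>S\<in>sets M. 1 - e \<le> prob S \<and> (\<forall>x\<in>S. Q n x)) \<longleftrightarrow> 1 - e \<le> prob {x \<in> space M. Q n x}" for e n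
  proof
    assume "\<exists>S\<in>sets M. 1 - e \<le> prob S \<and> (\<forall>x\<in>S. Q n x)"
    then obtain S where S: "S \<in> sets M" "1 - e \<le> prob S" "\<forall>x\<in>S. Q n x" by blast
    then have "prob S \<le> prob {x \<in> space M. Q n x}"
      using sets.sets_into_space[OF S(1)] by (intro finite_measure_mono) auto
    then show "1 - e \<le> prob {x \<in> space M. Q n x}" using S(2) by simp
  next
    assume *: "1 - e \<le> prob {x \<in> space M. Q n x}"
    have "{x \<in> space M. Q n x} \<in> sets M" by measurable
    with * show "\<exists>S\<in>sets M. 1 - e \<le> prob S \<and> (\<forall>x\<in>S. Q n x)" by blast
  qed
  then show ?thesis unfolding whp_def by simp
qed

lemma whp_conj:
  assumes "whp M Q" "whp M Q'"
  shows "whp M (\<lambda>n x. Q n x \<and> Q' n x)"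
  unfolding whp_def
proof (intro allI impI)
  fix e :: real assume "0 < e"
  then have "eventually (\<lambda>n. \<exists>S\<in>sets M. 1 - e/2 \<le> prob S \<and> (\<forall>x\<in>S. Q n x)) sequentially"
    "eventually (\<lambda>n. \<exists>S\<in>sets M. 1 - e/2 \<le> prob S \<and> (\<forall>x\<in>S. Q' n x)) sequentially"
    using assms unfolding whp_def by (auto dest: spec[of _ "e/2"])
  then show "eventually (\<lambda>n. \<exists>S\<in>sets M. 1 - e \<le> prob S \<and> (\<forall>x\<in>S. Q n x \<and> Q' n x)) sequentially"
  proof eventually_elim
    case (elim n)
    then obtain S S' where S: "S \<in> sets M" "1 - e/2 \<le> prob S" "\<forall>x\<in>S. Q n x"
      and S': "S' \<in> sets M" "1 - e/2 \<le> prob S'" "\<forall>x\<in>S'. Q' n x" by blast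
    have "prob S + prob S' = prob (S \<union> S') + prob (S \<inter> S')"
      using measure_Un3[of S M S'] S(1) S'(1) by (simp add: fmeasurable_eq_sets)
    then have "1 - e \<le> prob (S \<inter> S')" using S(2) S'(2) prob_le_1[of "S \<union> S'"] by linarith
    then show ?case using S S' by (intro bexI[of _ "S \<inter> S'"]) auto
  qed
qed

lemma whp_ball:
  assumes "finite I" "\<And>i. i \<in> I \<Longrightarrow> whp M (Q i)"
  shows "whp M (\<lambda>n x. \<forall>i\<in>I. Q i n x)"
  using assms
proof (induction I rule: finite_induct)
  case empty
  then show ?case unfolding whp_def by (auto intro!: always_eventually bexI[of _ "space M"] simp: prob_space)
next
  case (insert i I)
  then have "whp M (\<lambda>n x. Q i n x \<and> (\<forall>i\<in>I. Q i n x))" by (intro whp_conj) auto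
  then show ?case by (rule whp_mono) auto
qed

text \<open>A set of probability at least \<open>p\<close> cannot avoid one of probability at least
  \<open>1 - p/2\<close>. Contradictions will be read off a single path that lies in both.\<close>

lemma whp_meets:
  assumes "whp M Q" "0 < p" "\<And>n. F n \<in> sets M" "\<And>n. p \<le> prob (F n)"
  shows "eventually (\<lambda>n. \<exists>x\<in>F n. Q n x) sequentially"
proof -
  have "eventually (\<lambda>n. \<exists>S\<in>sets M. 1 - p/2 \<le> prob S \<and> (\<forall>x\<in>S. Q n x)) sequentially"
    using assms(1,2) unfolding whp_def by (auto dest: spec[of _ "p/2"])
  then show ?thesis
  proof eventually_elim
    case (elim n)
    then obtain S where S: "S \<in> sets M" "1 - p/2 \<le> prob S" "\<forall>x\<in>S. Q n x" by blast
    have "S \<inter> F n \<noteq> {}"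
    proof
      assume "S \<inter> F n = {}"
      then have "prob S + prob (F n) = prob (S \<union> F n)"
        using S(1) assms(3) by (intro finite_measure_Union[symmetric]) auto
      then show False using S(2) assms(2) assms(4)[of n] prob_le_1[of "S \<union> F n"] by simp
    qed
    then show ?case using S(3) by blast
  qed
qed

lemma whp_exists:
  assumes "whp M Q"
  shows "eventually (\<lambda>n. \<exists>x\<in>space M. Q n x) sequentially"
  by (rule whp_meets[OF assms, of 1 "\<lambda>_. space M"]) (auto simp: prob_space)

lemma whp_AE_eventually:
  assumes [measurable]: "\<And>n. Measurable.pred M (Q n)"
    and "AE x in M. eventually (\<lambda>n. Q n x) sequentially"
  shows "whp M Q"
  unfolding whp_def
proof (intro allI impI)
  fix e :: real assume "0 < e"
  define E where "E n = {x \<in> space M. \<forall>m\<ge>n. Q m x}" for n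
  have [measurable]: "E n \<in> sets M" for n unfolding E_def by measurable
  have "incseq E" by (auto simp: incseq_def E_def)
  then have "(\<lambda>n. prob (E n)) \<longlonglongrightarrow> prob (\<Union>n. E n)"
    by (intro finite_Lim_measure_incseq) auto
  moreover have "prob (\<Union>n. E n) = 1"
    by (rule prob_eq_1[THEN iffD2])
       (use assms(2) AE_space in \<open>auto simp: E_def eventually_sequentially elim!: eventually_elim2\<close>)
  ultimately have "eventually (\<lambda>n. 1 - e < prob (E n)) sequentially"
    using \<open>0 < e\<close> by (intro order_tendstoD) auto
  then show "eventually (\<lambda>n. \<exists>S\<in>sets M. 1 - e \<le> prob S \<and> (\<forall>x\<in>S. Q n x)) sequentially"
  proof eventually_elim
    case (elim n)
    then show ?case by (intro bexI[of _ "E n"]) (auto simp: E_def)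
  qed
qed

lemma AE_tendsto_imp_in_prob:
  assumes [measurable]: "\<And>n. X n \<in> borel_measurable M"
    and lim: "AE x in M. (\<lambda>n. X n x) \<longlonglongrightarrow> l"
  shows "in_prob M X l"
  unfolding in_prob_def
proof (intro conjI allI impI)
  fix b :: real
  show "whp M (\<lambda>n x. ereal b < X n x)" if "ereal b < l"
    by (rule whp_AE_eventually, measurable) (use lim in eventually_elim, rule order_tendstoD(1)[OF _ that])
  show "whp M (\<lambda>n x. X n x < ereal b)" if "l < ereal b"
    by (rule whp_AE_eventually, measurable) (use lim in eventually_elim, rule order_tendstoD(2)[OF _ that])
qed

text \<open>The almost sure limit \<open>L\<close> is random at first. If it differed from
  \<open>l\<close>, a rational threshold strictly between them would separate it from
  \<open>l\<close>, and an event of probability tending to 1 would eventually fail there.\<close>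

lemma in_prob_AE_unique:
  assumes [measurable]: "\<And>n. X n \<in> borel_measurable M"
    and X: "in_prob M X l" and lim: "AE x in M. \<exists>L. (\<lambda>n. X n x) \<longlonglongrightarrow> L"
  shows "AE x in M. (\<lambda>n. X n x) \<longlonglongrightarrow> l"
proof -
  \<comment> \<open>If \<open>Q n\<close> eventually failed with positive probability, it would fail
    for all \<open>n \<ge> k\<close> on one fixed set \<open>F k\<close> of positive probability,
    against \<open>whp_meets\<close>.\<close>
  have *: "AE x in M. \<not> (eventually (\<lambda>n. \<not> Q n x) sequentially)"
    if [measurable]: "\<And>n. Measurable.pred M (Q n)" and Q: "whp M Q" for Q
  proof -
    define E where "E = {x \<in> space M. eventually (\<lambda>n. \<not> Q n x) sequentially}"
    have E[measurable]: "E \<in> sets M" unfolding E_def by measurable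
    have "prob E = 0"
    proof (rule ccontr)
      assume "prob E \<noteq> 0"
      then have "0 < prob E" by (simp add: zero_less_measure_iff)
      define F where "F n = {x \<in> E. \<forall>m\<ge>n. \<not> Q m x}" for n
      have F_alt: "F n = E \<inter> {x \<in> space M. \<forall>m\<ge>n. \<not> Q m x}" for n
        using sets.sets_into_space[OF E] by (auto simp: F_def)
      have [measurable]: "F n \<in> sets M" for n unfolding F_alt by measurable
      have "incseq F" by (auto simp: incseq_def F_def)
      then have "(\<lambda>n. prob (F n)) \<longlonglongrightarrow> prob (\<Union>n. F n)"
        by (intro finite_Lim_measure_incseq) auto
      moreover have "(\<Union>n. F n) = E" by (auto simp: F_def E_def eventually_sequentially)
      ultimately have "eventually (\<lambda>n. 0 < prob (F n)) sequentially"
        using \<open>0 < prob E\<close> by (intro order_tendstoD) auto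
      then obtain k where k: "0 < prob (F k)" by (auto simp: eventually_sequentially)
      have "eventually (\<lambda>n. \<exists>x\<in>F k. Q n x) sequentially"
        by (rule whp_meets[OF Q k]) auto
      then obtain n where "n \<ge> k" "\<exists>x\<in>F k. Q n x"
        unfolding eventually_sequentially by (meson nle_le)
      then show False by (auto simp: F_def)
    qed
    then have "AE x in M. x \<notin> E" by (intro AE_not_in) (auto simp: null_sets_def emeasure_eq_measure)
    with AE_space show ?thesis by eventually_elim (auto simp: E_def)
  qed
  have "AE x in M. \<forall>q::rat. (ereal (real_of_rat q) < l \<longrightarrow> \<not> eventually (\<lambda>n. \<not> ereal (real_of_rat q) < X n x) sequentially) \<and>
     (l < ereal (real_of_rat q) \<longrightarrow> \<not> eventually (\<lambda>n. \<not> X n x < ereal (real_of_rat q)) sequentially)"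
    unfolding AE_all_countable
  proof
    fix q :: rat
    have "AE x in M. ereal (real_of_rat q) < l \<longrightarrow> \<not> eventually (\<lambda>n. \<not> ereal (real_of_rat q) < X n x) sequentially"
      using *[of "\<lambda>n x. ereal (real_of_rat q) < X n x"] X by (cases "ereal (real_of_rat q) < l") (auto simp: in_prob_def)
    moreover have "AE x in M. l < ereal (real_of_rat q) \<longrightarrow> \<not> eventually (\<lambda>n. \<not> X n x < ereal (real_of_rat q)) sequentially"
      using *[of "\<lambda>n x. X n x < ereal (real_of_rat q)"] X by (cases "l < ereal (real_of_rat q)") (auto simp: in_prob_def)
    ultimately show "AE x in M. (ereal (real_of_rat q) < l \<longrightarrow> \<not> eventually (\<lambda>n. \<not> ereal (real_of_rat q) < X n x) sequentially) \<and>
     (l < ereal (real_of_rat q) \<longrightarrow> \<not> eventually (\<lambda>n. \<not> X n x < ereal (real_of_rat q)) sequentially)"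
      by eventually_elim simp
  qed
  with lim show ?thesis
  proof eventually_elim
    case (elim x)
    then obtain L where L: "(\<lambda>n. X n x) \<longlonglongrightarrow> L" by blast
    have "L = l"
    proof (rule antisym; rule ccontr)
      assume "\<not> L \<le> l"
      then obtain q where q: "l < ereal (real_of_rat q)" "ereal (real_of_rat q) < L"
        using ereal_dense3[of l L] by (auto simp: not_le)
      have "eventually (\<lambda>n. \<not> X n x < ereal (real_of_rat q)) sequentially"
        using order_tendstoD(1)[OF L q(2)] by eventually_elim auto
      then show False using elim(2) q(1) by blast
    next
      assume "\<not> l \<le> L"
      then obtain q where q: "L < ereal (real_of_rat q)" "ereal (real_of_rat q) < l"
        using ereal_dense3[of L l] by (auto simp: not_le)
      have "eventually (\<lambda>n. \<not> ereal (real_of_rat q) < X n x) sequentially"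
        using order_tendstoD(2)[OF L q(1)] by eventually_elim auto
      then show False using elim(2) q(2) by blast
    qed
    then show ?case using L by simp
  qed
qed

end

text \<open>Convergence in probability to a constant depends only on the law of each single term.
  This is why it passes between \<open>x(n,0)\<close> and \<open>y(n,0)\<close>, whose equality in
  law holds for each \<open>n\<close> separately.\<close>

lemma in_prob_distr_cong:
  assumes "prob_space M" "prob_space N"
    and [measurable]: "\<And>n. X n \<in> borel_measurable M" "\<And>n. Y n \<in> borel_measurable N"
    and eq: "\<And>n. distr M borel (X n) = distr N borel (Y n)" and X: "in_prob M X l"
  shows "in_prob N Y l"
proof -
  interpret M: prob_space M by fact
  interpret N: prob_space N by fact
  have "whp M (\<lambda>n x. X n x \<in> S) \<longleftrightarrow> whp N (\<lambda>n x. Y n x \<in> S)" if [measurable]: "S \<in> sets borel" for S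
  proof -
    have "measure M {x \<in> space M. X n x \<in> S} = measure N {x \<in> space N. Y n x \<in> S}" for n
      using arg_cong[OF eq, of "\<lambda>M. measure M S" n]
      by (simp add: measure_distr vimage_def Int_def conj_commute)
    then show ?thesis by (simp add: M.whp_measurable_iff N.whp_measurable_iff)
  qed
  from this[of "{ereal b<..}" for b] this[of "{..<ereal b}" for b] X
  show ?thesis unfolding in_prob_def by simp
qed

lemma whp_Suc: "whp M Q \<Longrightarrow> whp M (\<lambda>n. Q (Suc n))"
  unfolding whp_def
proof (intro allI impI)
  fix e :: real
  assume "\<forall>e>0. eventually (\<lambda>n. \<exists>S\<in>sets M. 1 - e \<le> measure M S \<and> (\<forall>x\<in>S. Q n x)) sequentially" "0 < e"
  then have "eventually (\<lambda>n. \<exists>S\<in>sets M. 1 - e \<le> measure M S \<and> (\<forall>x\<in>S. Q n x)) sequentially" by blast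
  from eventually_compose_filterlim[OF this filterlim_Suc]
  show "eventually (\<lambda>n. \<exists>S\<in>sets M. 1 - e \<le> measure M S \<and> (\<forall>x\<in>S. Q (Suc n) x)) sequentially" .
qed

lemma (in prob_space) whp_AE:
  assumes "AE x in M. P x"
  shows "whp M (\<lambda>_. P)"
proof -
  from assms obtain N where N: "{x \<in> space M. \<not> P x} \<subseteq> N" "emeasure M N = 0" "N \<in> sets M"
    by (rule AE_E)
  then have "prob (space M - N) = 1" by (subst prob_compl) (simp_all add: measure_def)
  then show ?thesis
    unfolding whp_def using N(1,3) by (auto intro!: bexI[of _ "space M - N"])
qed

section \<open>Growth rates of the components\<close>

lemma ereal_less_divide_iff:
  "0 < n \<Longrightarrow> ereal c < x / ereal (real n) \<longleftrightarrow> ereal (c * real n) < x"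
  by (subst ereal_less_divide_pos) (auto simp: mult.commute)

lemma ereal_divide_less_iff:
  "0 < n \<Longrightarrow> x / ereal (real n) < ereal c \<longleftrightarrow> x < ereal (c * real n)"
  by (subst ereal_divide_less_pos) (auto simp: mult.commute)

text \<open>A gap between two rates absorbs a constant and one unit of time, whichever side is one
  step ahead.\<close>

lemma eventually_linear_gap:
  fixes b c K :: real
  assumes "b < c"
  shows "eventually (\<lambda>n. K + b * real n \<le> c * real (Suc n)) sequentially"
    "eventually (\<lambda>n. K + b * real (Suc n) \<le> c * real n) sequentially"
proof -
  have *: "eventually (\<lambda>n. \<bar>K\<bar> + \<bar>b\<bar> + \<bar>c\<bar> \<le> (c - b) * real n) sequentially"
    using eventually_ge_at_top[of "nat \<lceil>(\<bar>K\<bar> + \<bar>b\<bar> + \<bar>c\<bar>) / (c - b)\<rceil>"]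
  proof eventually_elim
    case (elim n)
    then have "(\<bar>K\<bar> + \<bar>b\<bar> + \<bar>c\<bar>) / (c - b) \<le> real n" by linarith
    then show ?case using assms by (simp add: field_simps)
  qed
  show "eventually (\<lambda>n. K + b * real n \<le> c * real (Suc n)) sequentially"
    using *
  proof eventually_elim
    case (elim n)
    then have "K + b * real n \<le> c * real n + c" unfolding left_diff_distrib by linarith
    then show ?case by (simp add: algebra_simps)
  qed
  show "eventually (\<lambda>n. K + b * real (Suc n) \<le> c * real n) sequentially"
    using *
  proof eventually_elim
    case (elim n)
    then have "K + (b * real n + b) \<le> c * real n" unfolding left_diff_distrib by linarith
    then show ?case by (simp add: algebra_simps)
  qed
qed

text \<open>The cost \<open>K\<close> of one step does not depend on \<open>n\<close>, so it
  disappears after division by \<open>n\<close>.\<close>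

lemma lim_le_of_Suc_le:
  fixes X Y :: "nat \<Rightarrow> ereal" and K :: real
  assumes le: "\<And>n. X (Suc n) \<le> ereal K + Y n"
    and X: "(\<lambda>n. X n / ereal (real n)) \<longlonglongrightarrow> l" and Y: "(\<lambda>n. Y n / ereal (real n)) \<longlonglongrightarrow> l'"
  shows "l \<le> l'"
proof (rule ccontr)
  assume "\<not> l \<le> l'"
  then obtain c where c: "l' < ereal c" "ereal c < l" using ereal_dense2[of l' l] by (auto simp: not_le)
  then obtain b where b: "l' < ereal b" "b < c" using ereal_dense2[of l' "ereal c"] by auto
  have "eventually (\<lambda>n. ereal c < X (Suc n) / ereal (real (Suc n))) sequentially"
    using order_tendstoD(1)[OF LIMSEQ_Suc[OF X] c(2)] .
  moreover have "eventually (\<lambda>n. Y n / ereal (real n) < ereal b) sequentially"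
    using order_tendstoD(2)[OF Y b(1)] .
  ultimately have "eventually (\<lambda>n. False) sequentially"
    using eventually_linear_gap(1)[OF b(2), of K] eventually_gt_at_top[of 0]
  proof eventually_elim
    case (elim n)
    have "ereal (c * real (Suc n)) < X (Suc n)"
      using elim(1) ereal_less_divide_iff[of "Suc n" c] by (metis zero_less_Suc)
    also have "\<dots> \<le> ereal K + Y n" by (rule le)
    also have "\<dots> \<le> ereal K + ereal (b * real n)"
      using elim(2,4) by (intro add_left_mono) (simp add: ereal_divide_less_iff)
    finally show ?case using elim(3) by simp
  qed
  then show False by simp
qed

section \<open>Path laws and the shift\<close>

lemma AE_path_lawD:
  assumes "\<And>t. A t \<in> borel_measurable M" "AE u in path_law M A. P u"
  shows "AE \<omega> in M. P (\<lambda>t. A t \<omega>)"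
  using AE_distrD[OF path_measurable[of A M, OF assms(1)]] assms(2) unfolding path_law_def .

lemma AE_path_law_iff:
  assumes "\<And>t. A t \<in> borel_measurable M" "Measurable.pred paths P"
  shows "(AE u in path_law M A. P u) \<longleftrightarrow> (AE \<omega> in M. P (\<lambda>t. A t \<omega>))"
  unfolding path_law_def using assms(2)
  by (intro AE_distr_iff path_measurable assms(1)) (simp add: pred_def space_PiM)

lemma distr_path_law:
  assumes "\<And>t. A t \<in> borel_measurable M" "f \<in> measurable paths N"
  shows "distr (path_law M A) N f = distr M N (\<lambda>\<omega>. f (\<lambda>t. A t \<omega>))"
  unfolding path_law_def using assms(2)
  by (subst distr_distr[OF _ path_measurable[OF assms(1)]]) (auto simp: o_def)

lemma stationary_distr_shift:
  assumes "\<And>t. A t \<in> borel_measurable M" "stationary M A"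
  shows "distr (path_law M A) paths shift = path_law M A"
proof -
  have "distr (path_law M A) paths shift = path_law M (\<lambda>t. A (t + 1))"
    by (subst distr_path_law) (auto simp: assms(1) path_law_def shift_def)
  then show ?thesis using assms(2) by (simp add: stationary_def)
qed

text \<open>The oldest matrix \<open>u 0\<close> is used in the last step of \<open>q\<close>;
  without that step, \<open>q\<close> is a walk for the shifted path.\<close>

lemma rev_weight_Suc_le:
  fixes u :: "nat \<Rightarrow> ereal^'d^'d"
  assumes u: "\<And>t i j. u t $ i $ j \<noteq> \<infinity>" and K: "\<And>i j. u 0 $ i $ j \<le> ereal K"
  shows "rev_weight u q (Suc n) \<le> ereal K + rev_weight (shift u) q n"
proof -
  have "rev_weight u q (Suc n) = rev_weight (shift u) q n + u 0 $ q n $ q (Suc n)"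
    unfolding rev_weight_def shift_def by (auto simp: Suc_diff_Suc intro!: arg_cong2[where f="(+)"] sum.cong)
  also have "\<dots> \<le> rev_weight (shift u) q n + ereal K" by (intro add_left_mono K)
  finally show ?thesis by (simp add: add.commute)
qed

text \<open>The hypotheses of the theorem. The arguments take place on the path law rather than on
  \<open>M\<close>, since there the shift acts as a measure-preserving map.\<close>

locale mp_sequence =
  fixes M :: "'a measure" and A :: "nat \<Rightarrow> 'a \<Rightarrow> ereal^'d^'d"
  assumes prob_space_M: "prob_space M"
    and random_matrix: "\<And>n. rmax_random_matrix M (A n)"
    and stationary: "stationary M A"
    and ergodic: "ergodic M A"
    and no_bot_line_UNIV: "no_bot_line M UNIV (A 0)"
    and integrable_pos: "integrable M (\<lambda>\<omega>. real_of_ereal (MAX i. MAX j. max (A 0 \<omega> $ i $ j) 0))"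
begin

sublocale base: prob_space M by (rule prob_space_M)

abbreviation law :: "(nat \<Rightarrow> ereal^'d^'d) measure" where "law \<equiv> path_law M A"

definition entry_bound :: "(nat \<Rightarrow> ereal^'d^'d) \<Rightarrow> real" where
  "entry_bound u = real_of_ereal (MAX i. MAX j. max (u 0 $ i $ j) 0)"

text \<open>The path space also contains paths with entries \<open>\<infinity>\<close> or rows of
  \<open>-\<infinity>\<close>. The good paths have neither at any time, and by
  \<open>AE_good\<close> they have full measure.\<close>

definition good :: "(nat \<Rightarrow> ereal^'d^'d) \<Rightarrow> bool" where
  "good u \<longleftrightarrow> (\<forall>t i j. u t $ i $ j \<noteq> \<infinity>) \<and> (\<forall>t i. \<exists>j. u t $ i $ j \<noteq> -\<infinity>)"

lemma A_measurable [measurable]: "A n \<in> borel_measurable M"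
  using random_matrix by (simp add: rmax_random_matrix_def)

lemma good_measurable [measurable]: "Measurable.pred paths good"
  unfolding good_def by measurable

lemma entry_bound_measurable [measurable]: "entry_bound \<in> borel_measurable paths"
proof -
  have "entry_bound = (\<lambda>u. real_of_ereal (SUP i. SUP j. max (u 0 $ i $ j) 0))"
    unfolding entry_bound_def by (simp add: Max_Sup)
  also have "\<dots> \<in> borel_measurable paths" by measurable
  finally show ?thesis .
qed

lemma Max_entry_ge: "u 0 $ i $ j \<le> (MAX i. MAX j. max (u 0 $ i $ j) (0::ereal))"
  "0 \<le> (MAX i. MAX j. max (u 0 $ i $ j) (0::ereal))"
proof -
  have *: "max (u 0 $ i $ j) 0 \<le> (MAX i. MAX j. max (u 0 $ i $ j) (0::ereal))" for i j
    by (rule order_trans[OF Max_ge[of "range (\<lambda>j. max (u 0 $ i $ j) 0)"] Max_ge]) auto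
  show "u 0 $ i $ j \<le> (MAX i. MAX j. max (u 0 $ i $ j) (0::ereal))"
    "0 \<le> (MAX i. MAX j. max (u 0 $ i $ j) (0::ereal))"
    using *[of i j] by auto
qed

lemma entry_bound_nonneg: "0 \<le> entry_bound u"
  unfolding entry_bound_def by (intro real_of_ereal_pos Max_entry_ge)

text \<open>\<open>real_of_ereal\<close> sends \<open>\<infinity>\<close> to 0, so the maximum has
  to be finite; it is, being attained at one of finitely many entries.\<close>

lemma entry_le_bound:
  assumes "\<And>t i j. u t $ i $ j \<noteq> \<infinity>"
  shows "u 0 $ i $ j \<le> ereal (entry_bound u)"
proof -
  have "(MAX i. MAX j. max (u 0 $ i $ j) (0::ereal)) \<in> range (\<lambda>i. MAX j. max (u 0 $ i $ j) 0)"
    by (rule Max_in) auto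
  then obtain i0 where i0: "(MAX i. MAX j. max (u 0 $ i $ j) (0::ereal)) = (MAX j. max (u 0 $ i0 $ j) 0)" by blast
  have "(MAX j. max (u 0 $ i0 $ j) 0) \<in> range (\<lambda>j. max (u 0 $ i0 $ j) 0)"
    by (rule Max_in) auto
  then have "(MAX i. MAX j. max (u 0 $ i $ j) (0::ereal)) \<noteq> \<infinity>"
    unfolding i0 using assms by (auto simp: max_def)
  then have "ereal (entry_bound u) = (MAX i. MAX j. max (u 0 $ i $ j) (0::ereal))"
    unfolding entry_bound_def using Max_entry_ge(2)[of u] by (simp add: ereal_real)
  then show ?thesis using Max_entry_ge(1)[of u i j] by simp
qed

sublocale law: prob_space law
  unfolding path_law_def by (intro base.prob_space_distr path_measurable A_measurable)

sublocale law: measure_preserving_system law shift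
proof
  show "shift \<in> measurable law law" by (simp cong: measurable_cong_sets)
  have "distr law law shift = distr law paths shift" by (rule distr_cong) simp_all
  also have "\<dots> = law" by (intro stationary_distr_shift A_measurable stationary)
  finally show "distr law law shift = law" .
qed

lemma AE_good: "AE u in law. good u"
proof -
  have "AE u in law. (\<forall>i j. u 0 $ i $ j \<noteq> \<infinity>) \<and> (\<forall>i. \<exists>j. u 0 $ i $ j \<noteq> -\<infinity>)"
    (is "AE u in law. ?P u")
  proof (subst AE_path_law_iff[OF A_measurable])
    show "Measurable.pred paths ?P" by measurable
    have "AE \<omega> in M. \<forall>i. \<exists>j. A 0 \<omega> $ i $ j \<noteq> -\<infinity>"
      using no_bot_line_UNIV by (simp add: no_bot_line_def)
    with AE_space show "AE \<omega> in M. ?P (\<lambda>t. A t \<omega>)"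
      by eventually_elim (use random_matrix[of 0] in \<open>auto simp: rmax_random_matrix_def\<close>)
  qed
  from law.AE_funpow_T[OF this] show ?thesis
    by eventually_elim (auto simp: good_def funpow_shift)
qed

sublocale law: walk_system law shift transposed entry_bound
proof
  show "(\<lambda>u. transposed u i j) \<in> borel_measurable law" for i j
    unfolding transposed_def by measurable
  show "integrable law entry_bound"
    unfolding path_law_def using integrable_pos
    by (subst integrable_distr_eq) (auto simp: entry_bound_def[abs_def, symmetric] path_measurable entry_bound_def)
  show "AE u in law. \<forall>i j. transposed u i j \<le> ereal (entry_bound u)"
    using AE_good by eventually_elim (auto simp: transposed_def good_def intro!: entry_le_bound)
qed (rule entry_bound_nonneg)

lemma top_entry_measurable [measurable]: "top_entry J n \<in> borel_measurable paths"
proof -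
  note [measurable] = mp_prod_measurable[of "\<lambda>k u. u k" paths J n, OF path_entry_measurable]
  show ?thesis unfolding top_entry_def[abs_def] by measurable
qed

lemma X_path_borel [measurable]: "(\<lambda>u. X_path n u i) \<in> borel_measurable paths"
  by (rule X_path_measurable[of "\<lambda>k u. u k"]) measurable

lemma shifted_event:
  assumes P: "Measurable.pred paths P"
  shows "{u. P ((shift ^^ n) u)} \<in> sets law"
    and "law.prob {u. P ((shift ^^ n) u)} = law.prob {u. P u}"
proof -
  have S: "{u. P u} \<in> sets law" using P by (simp add: pred_def space_PiM)
  have eq: "(shift ^^ n) -` {u. P u} \<inter> space law = {u. P ((shift ^^ n) u)}" by auto
  show "{u. P ((shift ^^ n) u)} \<in> sets law"
    using measurable_sets[OF law.funpow_T_measurable S, of n] unfolding eq .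
  have "law.prob {u. P u} = measure (distr law law (shift ^^ n)) {u. P u}" by (simp only: law.distr_funpow_T)
  also have "\<dots> = law.prob {u. P ((shift ^^ n) u)}"
    unfolding eq[symmetric] by (rule measure_distr[OF law.funpow_T_measurable S])
  finally show "law.prob {u. P ((shift ^^ n) u)} = law.prob {u. P u}" by simp
qed

lemma zero_one_law:
  assumes [measurable]: "Measurable.pred paths Q" and Q: "AE u in law. Q u \<longrightarrow> Q (shift u)"
  shows "(AE u in law. Q u) \<or> (AE u in law. \<not> Q u)"
proof -
  \<comment> \<open>Ergodicity concerns strictly invariant sets: replace \<open>Q\<close> by the forward invariant \<open>Q'\<close>, then
    take the increasing union \<open>S\<close> of its preimages under the shift, which all have the same measure.\<close>
  define Q' where "Q' u \<longleftrightarrow> (\<forall>k. Q ((shift ^^ k) u))" for u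
  have Q'_meas: "Measurable.pred paths Q'"
  proof -
    have "{u. Q ((shift ^^ k) u)} \<in> sets law" for k by (rule shifted_event(1)) fact
    then have [measurable]: "Measurable.pred paths (\<lambda>u. Q ((shift ^^ k) u))" for k
      by (simp add: pred_def space_PiM)
    show ?thesis unfolding Q'_def by measurable
  qed
  have Q'_iff: "AE u in law. Q u \<longleftrightarrow> Q' u"
    using law.AE_funpow_T[OF Q]
  proof eventually_elim
    case (elim u)
    have "Q ((shift ^^ k) u)" if "Q u" for k by (induction k) (use that elim in auto)
    moreover have "Q' u \<Longrightarrow> Q u" unfolding Q'_def by (drule spec[of _ 0]) simp
    ultimately show ?case by (auto simp: Q'_def)
  qed
  have Q'_shift: "Q' u \<Longrightarrow> Q' (shift u)" for u
    unfolding Q'_def by (metis comp_apply funpow_Suc_right)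
  have Q'_mono: "Q' ((shift ^^ n) u) \<Longrightarrow> n \<le> m \<Longrightarrow> Q' ((shift ^^ m) u)" for n m u
    by (induction m) (auto simp: le_Suc_eq Q'_shift)
  define S where "S = {u. \<exists>n. Q' ((shift ^^ n) u)}"
  define F where "F n = {u. Q' ((shift ^^ n) u)}" for n
  have S_UN: "S = (\<Union>n. F n)" by (auto simp: S_def F_def)
  have F_meas [measurable]: "F n \<in> sets law" for n
    unfolding F_def by (rule shifted_event(1)[OF Q'_meas])
  have prob_F: "law.prob (F n) = law.prob (F 0)" for n
    unfolding F_def shifted_event(2)[OF Q'_meas] by simp
  have "incseq F" by (auto simp: incseq_def F_def Q'_mono)
  then have lim: "(\<lambda>n. law.prob (F n)) \<longlonglongrightarrow> law.prob S"
    unfolding S_UN by (intro law.finite_Lim_measure_incseq image_subsetI F_meas)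
  have "law.prob (F 0) = law.prob S"
  proof (rule LIMSEQ_unique[OF _ lim])
    show "(\<lambda>n. law.prob (F n)) \<longlonglongrightarrow> law.prob (F 0)"
      by (rule tendsto_eventually) (rule always_eventually, rule allI, rule prob_F)
  qed
  moreover have "law.prob S \<in> {0, 1}"
  proof -
    have "S \<in> sets law" unfolding S_UN by measurable
    then have "S \<in> sets paths" by simp
    moreover have "(\<lambda>u t. u (t + 1)) -` S = S"
    proof (intro set_eqI iffI)
      fix u :: "nat \<Rightarrow> ereal^'d^'d"
      assume "u \<in> S"
      then obtain n where "Q' ((shift ^^ n) u)" by (auto simp: S_def)
      then have "Q' ((shift ^^ n) (shift u))" using Q'_shift by (simp flip: funpow_swap1)
      then show "u \<in> (\<lambda>u t. u (t + 1)) -` S" by (auto simp: S_def shift_def)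
    next
      fix u :: "nat \<Rightarrow> ereal^'d^'d"
      assume "u \<in> (\<lambda>u t. u (t + 1)) -` S"
      then obtain n where "Q' ((shift ^^ n) (shift u))" by (auto simp: S_def shift_def)
      then have "Q' ((shift ^^ Suc n) u)" by (simp add: funpow_swap1)
      then show "u \<in> S" unfolding S_def by blast
    qed
    ultimately show ?thesis using ergodic by (simp add: ergodic_def)
  qed
  ultimately have "law.prob (F 0) = 0 \<or> law.prob (F 0) = 1" by auto
  then show ?thesis
  proof
    assume "law.prob (F 0) = 0"
    then have "AE u in law. u \<notin> F 0"
      using F_meas[of 0] by (intro AE_not_in) (simp add: null_sets_def law.emeasure_eq_measure)
    with Q'_iff have "AE u in law. \<not> Q u" by eventually_elim (auto simp: F_def)
    then show ?thesis ..
  next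
    assume "law.prob (F 0) = 1"
    then have "AE u in law. u \<in> F 0" by (rule law.prob_eq_1[OF F_meas, THEN iffD1])
    with Q'_iff have "AE u in law. Q u" by eventually_elim (auto simp: F_def)
    then show ?thesis ..
  qed
qed

text \<open>By the last assumption, passing to the shifted path cannot decrease the limit
  \<open>f\<close>. The events \<open>f > c\<close> are therefore forward invariant almost surely,
  \<open>zero_one_law\<close> gives them probability 0 or 1, and \<open>AE_eq_constI\<close> yields
  the constant.\<close>

lemma AE_limit_const:
  fixes X :: "nat \<Rightarrow> (nat \<Rightarrow> ereal^'d^'d) \<Rightarrow> ereal"
  assumes [measurable]: "\<And>n. X n \<in> borel_measurable paths"
    and conv: "AE u in law. \<exists>l. l \<noteq> \<infinity> \<and> (\<lambda>n. X n u / ereal (real n)) \<longlonglongrightarrow> l"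
    and le: "AE u in law. \<exists>K::real. \<forall>n. X (Suc n) u \<le> ereal K + X n (shift u)"
  obtains l where "l \<noteq> \<infinity>" "AE u in law. (\<lambda>n. X n u / ereal (real n)) \<longlonglongrightarrow> l"
proof -
  define f where "f u = liminf (\<lambda>n. X n u / ereal (real n))" for u
  have [measurable]: "f \<in> borel_measurable paths" unfolding f_def[abs_def] by measurable
  have lim: "AE u in law. f u \<noteq> \<infinity> \<and> (\<lambda>n. X n u / ereal (real n)) \<longlonglongrightarrow> f u"
    using conv
  proof eventually_elim
    case (elim u)
    then obtain l where l: "l \<noteq> \<infinity>" "(\<lambda>n. X n u / ereal (real n)) \<longlonglongrightarrow> l" by blast
    then have "f u = l" unfolding f_def by (intro lim_imp_Liminf) auto
    then show ?case using l by simp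
  qed
  have mono: "AE u in law. f u \<le> f (shift u)"
    using law.AE_funpow_T[OF lim] le
  proof eventually_elim
    case (elim u)
    then obtain K :: real where "\<And>n. X (Suc n) u \<le> ereal K + X n (shift u)" by blast
    moreover have "(\<lambda>n. X n u / ereal (real n)) \<longlonglongrightarrow> f u"
      "(\<lambda>n. X n (shift u) / ereal (real n)) \<longlonglongrightarrow> f (shift u)"
      using elim(1)[rule_format, of 0] elim(1)[rule_format, of 1] by auto
    ultimately show ?case by (rule lim_le_of_Suc_le)
  qed
  obtain l where l: "AE u in law. f u = l"
  proof (rule law.AE_eq_constI)
    fix c :: real
    have "(AE u in law. \<not> f u \<le> ereal c) \<or> (AE u in law. \<not> \<not> f u \<le> ereal c)"
    proof (rule zero_one_law)
      show "AE u in law. \<not> f u \<le> ereal c \<longrightarrow> \<not> f (shift u) \<le> ereal c"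
        using mono by eventually_elim auto
    qed measurable
    then show "(AE u in law. f u \<le> ereal c) \<or> (AE u in law. \<not> f u \<le> ereal c)" by auto
  qed
  have "AE u in law. l \<noteq> \<infinity> \<and> (\<lambda>n. X n u / ereal (real n)) \<longlonglongrightarrow> l"
    using l lim by eventually_elim auto
  then have "AE u in law. l \<noteq> \<infinity>" "AE u in law. (\<lambda>n. X n u / ereal (real n)) \<longlonglongrightarrow> l"
    by auto
  then show thesis using that by simp
qed

lemma top_entry_Suc_le:
  assumes "good u" "J \<noteq> {}"
  shows "top_entry J (Suc n) u \<le> ereal (entry_bound u) + top_entry J n (shift u)"
  unfolding top_entry_def[of J "Suc n"]
proof (intro SUP_least)
  fix i j assume ij: "i \<in> J" "j \<in> J"
  have u: "\<And>t i j. u t $ i $ j \<noteq> \<infinity>" using assms(1) by (simp add: good_def)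
  consider "mp_prod J u (Suc n) $ i $ j = -\<infinity>" | q where "q 0 = i" "\<forall>k\<le>Suc n. q k \<in> J"
      "rev_weight u q (Suc n) = mp_prod J u (Suc n) $ i $ j"
    using mp_prod_attained[of u i J j "Suc n"] u ij by blast
  then show "mp_prod J u (Suc n) $ i $ j \<le> ereal (entry_bound u) + top_entry J n (shift u)"
  proof cases
    case 2
    have "mp_prod J u (Suc n) $ i $ j \<le> ereal (entry_bound u) + rev_weight (shift u) q n"
      unfolding 2(3)[symmetric] using u by (intro rev_weight_Suc_le entry_le_bound)
    also have "rev_weight (shift u) q n \<le> mp_prod J (shift u) n $ q 0 $ q n"
      using 2 by (intro rev_weight_le_mp_prod) auto
    also have "\<dots> \<le> top_entry J n (shift u)"
      unfolding top_entry_def using 2 by (intro SUP_upper2[of "q 0"] SUP_upper) auto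
    finally show ?thesis by (simp add: add_left_mono)
  qed simp
qed

text \<open>Walks confined to \<open>J\<close> give a random limit and \<open>AE_limit_const\<close>
  makes it constant. Two constant almost sure limits agree on a probability space, so the
  description in \<open>lyapunov\<close> denotes this constant.\<close>

lemma lyapunov_tendsto:
  assumes "J \<noteq> {}"
  shows "lyapunov M A J \<noteq> \<infinity>"
    and "AE u in law. (\<lambda>n. top_entry J n u / ereal (real n)) \<longlonglongrightarrow> lyapunov M A J"
proof -
  define R where "R i j \<longleftrightarrow> i \<in> J \<and> j \<in> J" for i j
  interpret R: walk_system law shift "restrict_steps R transposed" entry_bound
    by (rule law.walk_system_restrict)
  have conv: "AE u in law. \<exists>l. l \<noteq> \<infinity> \<and> (\<lambda>n. top_entry J n u / ereal (real n)) \<longlonglongrightarrow> l"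
    using R.AE_max_walk_converges AE_good
  proof eventually_elim
    case (elim u)
    from elim(1) obtain l where l: "\<And>i. l i \<noteq> \<infinity>"
      "\<And>i. (\<lambda>n. max_walk shift (restrict_steps R transposed) n u i / ereal (real n)) \<longlonglongrightarrow> l i"
      by metis
    have "(\<lambda>n. SUP i\<in>J. max_walk shift (restrict_steps R transposed) n u i / ereal (real n)) \<longlonglongrightarrow> (SUP i\<in>J. l i)"
      by (intro tendsto_finite_SUP l(2)) simp
    moreover have "eventually (\<lambda>n. (SUP i\<in>J. max_walk shift (restrict_steps R transposed) n u i / ereal (real n))
        = top_entry J n u / ereal (real n)) sequentially"
      using eventually_gt_at_top[of 0]
    proof eventually_elim
      case (elim n)
      have "top_entry J n u = (SUP i\<in>J. max_walk shift (restrict_steps R transposed) n u i)"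
        using \<open>good u\<close> by (subst top_entry_eq_SUP_max_walk) (auto simp: good_def R_def[abs_def])
      then show ?case using finite_SUP_ereal_divide[of J n] elim assms by simp
    qed
    ultimately have "(\<lambda>n. top_entry J n u / ereal (real n)) \<longlonglongrightarrow> (SUP i\<in>J. l i)"
      by (rule Lim_transform_eventually)
    moreover have "(SUP i\<in>J. l i) \<noteq> \<infinity>"
      using finite_SUP_attained[of J l] assms l(1) by (metis finite)
    ultimately show ?case by blast
  qed
  have le: "AE u in law. \<exists>K::real. \<forall>n. top_entry J (Suc n) u \<le> ereal K + top_entry J n (shift u)"
    using AE_good by eventually_elim (use top_entry_Suc_le assms in blast)
  obtain l where l: "l \<noteq> \<infinity>" "AE u in law. (\<lambda>n. top_entry J n u / ereal (real n)) \<longlonglongrightarrow> l"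
    by (rule AE_limit_const[OF top_entry_measurable conv le])
  have "AE \<omega> in M. (\<lambda>n. top_entry J n (\<lambda>k. A k \<omega>) / ereal (real n)) \<longlonglongrightarrow> l"
    by (rule AE_path_lawD[OF A_measurable l(2)])
  then have AE: "AE \<omega> in M. rmax_lim (\<lambda>n. top_entry J n (\<lambda>k. A k \<omega>) / ereal (real n)) l"
    by eventually_elim (simp add: rmax_lim_def l(1))
  have "lyapunov M A J = l"
    unfolding lyapunov_def top_entry_def[symmetric]
  proof (rule the_equality)
    show "AE \<omega> in M. rmax_lim (\<lambda>n. top_entry J n (\<lambda>k. A k \<omega>) / ereal (real n)) l" by (rule AE)
  next
    fix l' assume "AE \<omega> in M. rmax_lim (\<lambda>n. top_entry J n (\<lambda>k. A k \<omega>) / ereal (real n)) l'"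
    with AE have "AE \<omega> in M. l' = l"
      by eventually_elim (auto simp: rmax_lim_def intro: LIMSEQ_unique)
    then show "l' = l" by simp
  qed
  then show "lyapunov M A J \<noteq> \<infinity>"
    "AE u in law. (\<lambda>n. top_entry J n u / ereal (real n)) \<longlonglongrightarrow> lyapunov M A J"
    using l by auto
qed

section \<open>The graph and its components\<close>

abbreviation edge :: "'d \<Rightarrow> 'd \<Rightarrow> bool" where
  "edge i j \<equiv> 0 < measure M {\<omega> \<in> space M. A 0 \<omega> $ i $ j \<noteq> -\<infinity>}"

abbreviation reach :: "'d \<Rightarrow> 'd \<Rightarrow> bool" where
  "reach i j \<equiv> i \<rightarrow>\<^sup>*\<^bsub>mp_graph M A\<^esub> j"

lemma reach_iff: "reach i j \<longleftrightarrow> edge\<^sup>*\<^sup>* i j"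
proof -
  interpret wf_digraph "mp_graph M A"
    by unfold_locales (auto simp: mp_graph_def)
  have ends: "arcs_ends (mp_graph M A) = {(i, j). edge i j}" by (simp add: mp_graph_def)
  have verts: "verts (mp_graph M A) = UNIV" by (simp add: mp_graph_def)
  show ?thesis
  proof
    assume "reach i j"
    then have "(i, j) \<in> {(i, j). edge i j}\<^sup>*" using reachable_rtranclI ends by metis
    then show "edge\<^sup>*\<^sup>* i j" by (simp add: rtranclp_rtrancl_eq)
  next
    assume "edge\<^sup>*\<^sup>* i j"
    then show "reach i j"
    proof (induction rule: rtranclp_induct)
      case base
      show ?case using verts by simp
    next
      case (step j k)
      have "j \<rightarrow>\<^bsub>mp_graph M A\<^esub> k" using step(2) ends by simp
      with step(3) show ?case by (rule reachable_adj_trans)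
    qed
  qed
qed

lemma reach_refl: "reach i i" and reach_trans: "reach i j \<Longrightarrow> reach j k \<Longrightarrow> reach i k"
  and edge_reach: "edge i j \<Longrightarrow> reach i j"
  unfolding reach_iff by auto

lemma sccs_of_iff:
  "c \<in> sccs_of M A \<longleftrightarrow> (\<exists>i. c = {j. reach i j \<and> reach j i})"
proof
  assume "c \<in> sccs_of M A"
  then have c: "c \<noteq> {}" "\<And>u v. u \<in> c \<Longrightarrow> v \<in> c \<Longrightarrow> reach u v"
    "\<And>u v. u \<in> c \<Longrightarrow> v \<notin> c \<Longrightarrow> \<not> reach u v \<or> \<not> reach v u"
    unfolding sccs_of_def pre_digraph.sccs_verts_def by auto
  from c(1) obtain i where "i \<in> c" by blast
  then have "c = {j. reach i j \<and> reach j i}" using c(2,3) by blast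
  then show "\<exists>i. c = {j. reach i j \<and> reach j i}" by blast
next
  assume "\<exists>i. c = {j. reach i j \<and> reach j i}"
  then obtain i where c: "c = {j. reach i j \<and> reach j i}" by blast
  show "c \<in> sccs_of M A"
    unfolding sccs_of_def pre_digraph.sccs_verts_def c
  proof (intro CollectI conjI ballI allI impI)
    show "{j. reach i j \<and> reach j i} \<noteq> {}" using reach_refl by blast
  next
    fix v w assume "v \<in> {j. reach i j \<and> reach j i}" "w \<in> {j. reach i j \<and> reach j i}"
    then show "reach v w" using reach_trans[of v i w] by simp
  next
    fix v w assume v: "v \<in> {j. reach i j \<and> reach j i}" and w: "w \<notin> {j. reach i j \<and> reach j i}"
    then show "\<not> reach v w \<or> \<not> reach w v" using reach_trans[of i v w] reach_trans[of w v i] by auto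
  qed
qed

text \<open>Components are indexed by their nodes from here on: a component equals
  \<open>scc i\<close> for each of its nodes \<open>i\<close>.\<close>

definition scc :: "'d \<Rightarrow> 'd set" where
  "scc i = {j. reach i j \<and> reach j i}"

lemma scc_in_sccs: "scc i \<in> sccs_of M A"
  unfolding sccs_of_iff scc_def by (rule exI) (rule refl)

lemma in_scc: "i \<in> scc i"
  by (simp add: scc_def reach_refl)

lemma scc_eq: "c \<in> sccs_of M A \<Longrightarrow> i \<in> c \<Longrightarrow> c = scc i"
proof -
  assume "c \<in> sccs_of M A" "i \<in> c"
  then obtain k where c: "c = {j. reach k j \<and> reach j k}" unfolding sccs_of_iff by blast
  then have k: "reach k i" "reach i k" using \<open>i \<in> c\<close> by auto
  show "c = scc i"
    unfolding c scc_def using reach_trans[OF k(1)] reach_trans[OF k(2)]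
      reach_trans[OF _ k(1)] reach_trans[OF _ k(2)] by auto
qed

lemma leads_to_scc_iff: "leads_to M A (scc i) (scc j) \<longleftrightarrow> reach i j"
proof
  assume "leads_to M A (scc i) (scc j)"
  then show "reach i j"
    unfolding leads_to_def
  proof
    assume "scc i = scc j"
    then have "j \<in> scc i" using in_scc[of j] by simp
    then show "reach i j" by (simp add: scc_def)
  next
    assume "\<exists>k\<in>scc i. \<exists>l\<in>scc j. reach k l"
    then obtain k l where "reach i k" "reach k l" "reach l j" by (auto simp: scc_def)
    then show "reach i j" using reach_trans by metis
  qed
next
  assume "reach i j"
  then show "leads_to M A (scc i) (scc j)"
    unfolding leads_to_def using in_scc by blast
qed

lemma E_set_scc: "E_set M A (scc i) = scc ` {j. reach i j}"
proof -
  have "c \<in> E_set M A (scc i) \<longleftrightarrow> (\<exists>j. reach i j \<and> c = scc j)" for c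
  proof
    assume "c \<in> E_set M A (scc i)"
    then have c: "c \<in> sccs_of M A" "leads_to M A (scc i) c" by (auto simp: E_set_def)
    from c(1) obtain j where "c = scc j" unfolding sccs_of_iff scc_def by blast
    then show "\<exists>j. reach i j \<and> c = scc j" using c(2) leads_to_scc_iff by blast
  qed (auto simp: E_set_def scc_in_sccs leads_to_scc_iff)
  then show ?thesis by auto
qed

definition gam :: "'d \<Rightarrow> ereal" where
  "gam i = lyapunov M A (scc i)"

lemma gamma_down_scc: "gamma_down M A (scc i) = Max (gam ` {j. reach i j})"
  by (simp add: gamma_down_def E_set_scc gam_def image_image)

lemma gam_le_gamma_down: "reach i j \<Longrightarrow> gam j \<le> gamma_down M A (scc i)"
  unfolding gamma_down_scc by (intro Max_ge) auto

lemma gamma_down_attained: obtains j where "reach i j" "gam j = gamma_down M A (scc i)"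
proof -
  have "Max (gam ` {j. reach i j}) \<in> gam ` {j. reach i j}" using reach_refl by (intro Max_in) auto
  then show thesis using that unfolding gamma_down_scc by auto
qed

lemma gamma_down_neq_PInf: "gamma_down M A (scc i) \<noteq> \<infinity>"
proof -
  obtain j where j: "gam j = gamma_down M A (scc i)" by (rule gamma_down_attained)
  have "scc j \<noteq> {}" using in_scc by blast
  then show ?thesis using lyapunov_tendsto(1)[of "scc j"] j by (simp add: gam_def)
qed

lemma gamma_down_mono:
  assumes "reach i j"
  shows "gamma_down M A (scc j) \<le> gamma_down M A (scc i)"
proof -
  obtain k where k: "reach j k" "gam k = gamma_down M A (scc j)" by (rule gamma_down_attained)
  show ?thesis using gam_le_gamma_down[OF reach_trans[OF assms k(1)]] k(2) by simp
qed

lemma H_set_scc: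
  "H_set M A (scc i) = {j. reach i j \<and> (\<exists>k. reach j k \<and> gam k = gamma_down M A (scc i))}"
proof -
  have "j \<in> H_set M A (scc i) \<longleftrightarrow>
      reach i j \<and> (\<exists>k. reach j k \<and> gam k = gamma_down M A (scc i))" for j
  proof
    assume "j \<in> H_set M A (scc i)"
    then obtain c p where c: "j \<in> c" "c \<in> E_set M A (scc i)" "p \<in> sccs_of M A" "leads_to M A c p"
      "lyapunov M A p = gamma_down M A (scc i)" unfolding H_set_def G_set_def by blast
    have "c = scc j" using c(1,2) by (intro scc_eq) (auto simp: E_set_def)
    moreover obtain k where "p = scc k" using c(3) unfolding sccs_of_iff scc_def by blast
    ultimately show "reach i j \<and> (\<exists>k. reach j k \<and> gam k = gamma_down M A (scc i))"
      using c by (auto simp: E_set_def leads_to_scc_iff gam_def)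
  next
    assume "reach i j \<and> (\<exists>k. reach j k \<and> gam k = gamma_down M A (scc i))"
    then obtain k where "reach i j" "reach j k" "gam k = gamma_down M A (scc i)" by blast
    then have "scc j \<in> G_set M A (scc i)"
      unfolding G_set_def E_set_def
      by (auto simp: scc_in_sccs leads_to_scc_iff gam_def intro!: bexI[of _ "scc k"])
    then show "j \<in> H_set M A (scc i)" unfolding H_set_def using in_scc by blast
  qed
  then show ?thesis by auto
qed

lemma AE_edge: "AE u in law. \<forall>t i j. u t $ i $ j \<noteq> -\<infinity> \<longrightarrow> edge i j"
proof -
  have "AE u in law. \<forall>i j. u 0 $ i $ j \<noteq> -\<infinity> \<longrightarrow> edge i j" (is "AE u in law. ?P u")
  proof (subst AE_path_law_iff[OF A_measurable])
    show "Measurable.pred paths ?P" by measurable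
    have "AE \<omega> in M. A 0 \<omega> $ i $ j \<noteq> -\<infinity> \<longrightarrow> edge i j" for i j
    proof (cases "edge i j")
      case False
      then have "base.prob {\<omega> \<in> space M. A 0 \<omega> $ i $ j \<noteq> -\<infinity>} = 0"
        using measure_nonneg[of M "{\<omega> \<in> space M. A 0 \<omega> $ i $ j \<noteq> -\<infinity>}"] by linarith
      then have "AE \<omega> in M. \<not> A 0 \<omega> $ i $ j \<noteq> -\<infinity>"
        by (subst (asm) base.prob_Collect_eq_0) auto
      then show ?thesis by eventually_elim simp
    qed simp
    then show "AE \<omega> in M. ?P (\<lambda>t. A t \<omega>)" unfolding AE_all_countable by blast
  qed
  from law.AE_funpow_T[OF this] show ?thesis
    by eventually_elim (auto simp: funpow_shift)
qed

text \<open>All components reachable from \<open>i\<close> have exponents below \<open>b'\<close>,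
  so every state met by a walk of finite weight is losing at rate \<open>b'\<close> for walks
  confined to its component. The walk changes component at most \<open>CARD('d)\<close> times, and
  \<open>AE_walk_bound\<close> allows that many exceptional steps.\<close>

lemma AE_X_path_upper:
  assumes "gamma_down M A (scc i) < ereal b"
  shows "AE u in law. eventually (\<lambda>n. X_path n u i \<le> ereal (b * real n)) sequentially"
proof -
  obtain b' where b': "gamma_down M A (scc i) < ereal b'" "b' < b" using ereal_dense2[OF assms] by auto
  define R where "R j k \<longleftrightarrow> reach j k \<and> reach k j" for j k
  have "AE u in law. \<forall>j. reach i j \<longrightarrow> (\<exists>m\<ge>1. top_entry (scc j) m u \<le> ereal (b' * real m))"
    unfolding AE_all_countable
  proof (intro allI)
    fix j
    show "AE u in law. reach i j \<longrightarrow> (\<exists>m\<ge>1. top_entry (scc j) m u \<le> ereal (b' * real m))"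
    proof (cases "reach i j")
      case True
      have "scc j \<noteq> {}" using in_scc by blast
      then have "AE u in law. (\<lambda>n. top_entry (scc j) n u / ereal (real n)) \<longlonglongrightarrow> gam j"
        unfolding gam_def by (rule lyapunov_tendsto(2))
      then show ?thesis
      proof eventually_elim
        case (elim u)
        have "gam j < ereal b'" using gam_le_gamma_down[OF True] b'(1) by simp
        then have "eventually (\<lambda>n. top_entry (scc j) n u / ereal (real n) < ereal b') sequentially"
          using elim by (intro order_tendstoD(2))
        then have "eventually (\<lambda>n. 1 \<le> n \<and> top_entry (scc j) n u / ereal (real n) < ereal b') sequentially"
          using eventually_ge_at_top[of 1] by eventually_elim simp
        then obtain m where "1 \<le> m" "top_entry (scc j) m u / ereal (real m) < ereal b'"
          by (auto simp: eventually_sequentially)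
        then show ?case by (auto simp: ereal_divide_less_iff intro!: exI[of _ m])
      qed
    qed simp
  qed
  note losing = law.AE_funpow_T[OF this]
  show ?thesis
    using losing AE_good AE_edge law.AE_walk_bound[of R b']
  proof eventually_elim
    case (elim u)
    have u: "\<And>t i j. u t $ i $ j \<noteq> \<infinity>" using elim(2) by (simp add: good_def)
    obtain n0 where n0: "\<And>n p. n \<ge> n0 \<Longrightarrow>
      (\<forall>k<n. \<exists>m\<ge>1. max_walk shift (restrict_steps R transposed) m ((shift ^^ k) u) (p k) \<le> ereal (b' * real m)) \<Longrightarrow>
      card {k. k < n \<and> \<not> R (p k) (p (Suc k))} \<le> CARD('d) \<Longrightarrow>
      walk_weight shift transposed u p n \<le> ereal ((b' + (b - b')) * real n)"
      using elim(4)[rule_format, of "b - b'" "CARD('d)"] b'(2) by auto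
    have "X_path n u i \<le> ereal (b * real n)" if n: "n \<ge> n0" for n
    proof -
      obtain q where q: "q 0 = i" "rev_weight u q n = X_path n u i"
        using X_path_attained[of u i n] u by blast
      show ?thesis
      proof (cases "rev_weight u q n = -\<infinity>")
        case True
        then show ?thesis using q(2) by simp
      next
        case False
        \<comment> \<open>No entry is \<open>\<infinity>\<close>, so a single entry
          \<open>-\<infinity>\<close> would make the whole weight \<open>-\<infinity>\<close>; hence
          the optimal walk follows arcs of the graph.\<close>
        have arcs: "edge (q k) (q (Suc k))" if "k < n" for k
        proof -
          have "u (n - Suc k) $ q k $ q (Suc k) \<noteq> -\<infinity>"
          proof
            assume "u (n - Suc k) $ q k $ q (Suc k) = -\<infinity>"
            then have "rev_weight u q n = -\<infinity> + (\<Sum>l\<in>{..<n} - {k}. u (n - Suc l) $ q l $ q (Suc l))"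
              unfolding rev_weight_def using that by (subst sum.remove[of _ k]) auto
            moreover have "(\<Sum>l\<in>{..<n} - {k}. u (n - Suc l) $ q l $ q (Suc l)) \<noteq> \<infinity>"
              using u by (simp add: sum_Pinfty)
            ultimately show False using False by simp
          qed
          then show ?thesis using elim(3) by blast
        qed
        have reach_q: "reach (q k) (q l)" if "k \<le> l" "l \<le> n" for k l
          using that
        proof (induction l)
          case (Suc l)
          then show ?case
            using reach_refl reach_trans[OF _ edge_reach[OF arcs[of l]]] by (cases "k = Suc l") auto
        qed (simp add: reach_refl)
        \<comment> \<open>A node at which the walk leaves its component is never revisited, so \<open>p\<close> is injective on \<open>X\<close>.\<close>
        define p where "p k = q (n - k)" for k
        define X where "X = {k. k < n \<and> \<not> R (p k) (p (Suc k))}"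
        have "inj_on p X"
        proof (rule linorder_inj_onI)
          fix k k' assume k: "k < k'" "k \<in> X" "k' \<in> X"
          show "p k \<noteq> p k'"
          proof
            assume eq: "p k = p k'"
            have "reach (p (Suc k)) (p k)" "reach (p k') (p (Suc k))"
              unfolding p_def using k by (auto intro!: reach_q simp: X_def)
            then have "R (p k) (p (Suc k))" unfolding R_def eq by simp
            then show False using k(2) by (simp add: X_def)
          qed
        qed auto
        then have card: "card X \<le> CARD('d)" by (metis card_image card_mono finite subset_UNIV)
        have losing: "\<exists>m\<ge>1. max_walk shift (restrict_steps R transposed) m ((shift ^^ k) u) (p k) \<le> ereal (b' * real m)"
          if "k < n" for k
        proof -
          have "reach i (p k)" using reach_q[of 0 "n - k"] q(1) by (simp add: p_def)
          then obtain m where m: "1 \<le> m" "top_entry (scc (p k)) m ((shift ^^ k) u) \<le> ereal (b' * real m)"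
            using elim(1) by blast
          have "max_walk shift (restrict_steps R transposed) m ((shift ^^ k) u) (p k) \<le> top_entry (scc (p k)) m ((shift ^^ k) u)"
          proof (rule max_walk_le_top_entry)
            show "(shift ^^ k) u t $ i $ j \<noteq> \<infinity>" for t i j using u by (simp add: funpow_shift)
            show "R i j \<Longrightarrow> i \<in> scc (p k) \<Longrightarrow> j \<in> scc (p k)" for i j
              unfolding R_def scc_def using reach_trans[of "p k" i j] reach_trans[of j i "p k"] by simp
          qed (rule in_scc)
          then show ?thesis using m by (auto intro: order_trans)
        qed
        have "walk_weight shift transposed u p n \<le> ereal ((b' + (b - b')) * real n)"
          by (rule n0[OF n _ card[unfolded X_def]]) (intro allI impI losing)
        then show ?thesis using q(2) by (simp add: rev_weight_eq_walk_weight p_def[abs_def])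
      qed
    qed
    then show ?case by (auto simp: eventually_sequentially)
  qed
qed


section \<open>Deterministic limits\<close>

text \<open>By stationarity the event \<open>P\<close>, seen from time \<open>n\<close>, has the
  same positive probability for all \<open>n\<close>, so \<open>whp_meets\<close> applies. The
  result is a path with a prescribed matrix at time \<open>n\<close> and typical growth up to about
  time \<open>n\<close>.\<close>

lemma eventually_shifted_event_meets:
  assumes P: "Measurable.pred paths P" and pos: "\<not> (AE u in law. \<not> P u)" and Q: "whp law Q"
  shows "eventually (\<lambda>n. \<exists>u. P ((shift ^^ n) u) \<and> Q n u) sequentially"
proof -
  have "{u. P u} \<in> sets law" using P by (simp add: pred_def space_PiM)
  then have "law.prob {u. P u} \<noteq> 0" using pos law.prob_Collect_eq_0[of P] by simp
  then have "0 < law.prob {u. P u}" by (simp add: zero_less_measure_iff)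
  then have "eventually (\<lambda>n. \<exists>u\<in>{u. P ((shift ^^ n) u)}. Q n u) sequentially"
    using shifted_event[OF P] by (intro law.whp_meets[OF Q]) auto
  then show ?thesis by simp
qed

text \<open>One half of the recursion \<open>x(n+1,0) = A(n) x(n,0)\<close>; the other half is
  \<open>X_path_Suc_le\<close>.\<close>

lemma X_path_Suc_ge:
  assumes "good u"
  shows "u n $ i $ j + X_path n u j \<le> X_path (Suc n) u i"
proof -
  obtain q where q: "q 0 = j" "rev_weight u q n = X_path n u j"
    using X_path_attained[of u j n] assms by (auto simp: good_def)
  have "rev_weight u (case_nat i q) (Suc n) = u n $ i $ j + X_path n u j"
    unfolding rev_weight_Suc by (simp add: q)
  then show ?thesis using rev_weight_le_X_path[of u "case_nat i q" "Suc n"] by simp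
qed

lemma X_path_Suc_le:
  assumes "good u"
  obtains k where "X_path (Suc n) u i \<le> u n $ i $ k + X_path n u k"
proof -
  obtain q where q: "q 0 = i" "rev_weight u q (Suc n) = X_path (Suc n) u i"
    using X_path_attained[of u i "Suc n"] assms by (auto simp: good_def)
  have "X_path (Suc n) u i = u n $ i $ q 1 + rev_weight u (\<lambda>k. q (Suc k)) n"
    using q by (simp add: rev_weight_Suc)
  also have "\<dots> \<le> u n $ i $ q 1 + X_path n u (q 1)"
    using rev_weight_le_X_path[of u "\<lambda>k. q (Suc k)" n] by (intro add_left_mono) simp
  finally show thesis by (rule that)
qed

context
  fixes l :: "'d \<Rightarrow> ereal"
  assumes in_prob_l: "\<And>i. in_prob law (\<lambda>n u. X_path n u i / ereal (real n)) (l i)"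
begin

lemma whp_less: "l i < ereal b \<Longrightarrow> whp law (\<lambda>n u. X_path n u i / ereal (real n) < ereal b)"
  and whp_greater: "ereal b < l i \<Longrightarrow> whp law (\<lambda>n u. ereal b < X_path n u i / ereal (real n))"
  using in_prob_l[of i] unfolding in_prob_def by auto

text \<open>Suppose \<open>l i < b < c < l j\<close>. With probability bounded below, the entry
  \<open>(i, j)\<close> at time \<open>n\<close> exceeds a fixed \<open>- K\<close>. On some such
  path the recursion gives \<open>x\<^sub>i(n+1,0)\<close> at least \<open>c n - K\<close>, yet it
  is below \<open>b (n + 1)\<close>, which is impossible for large \<open>n\<close>.\<close>

lemma edge_limit_le:
  assumes "edge i j"
  shows "l j \<le> l i"
proof (rule ccontr)
  assume "\<not> l j \<le> l i"
  then obtain b where b: "l i < ereal b" "ereal b < l j" using ereal_dense2[of "l i" "l j"] by (auto simp: not_le)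
  then obtain c where c: "b < c" "ereal c < l j" using ereal_dense2[of "ereal b" "l j"] by auto
  \<comment> \<open>The arc only says that the entry is finite with positive probability. A uniform
    lower bound \<open>- K\<close> is gained by countable additivity.\<close>
  have "\<exists>K::nat. \<not> (AE u in law. \<not> ereal (- real K) < u 0 $ i $ j)"
  proof (rule ccontr)
    assume "\<not> ?thesis"
    then have "AE u in law. \<forall>K::nat. \<not> ereal (- real K) < u 0 $ i $ j"
      by (subst AE_all_countable) blast
    then have "AE u in law. u 0 $ i $ j = -\<infinity>"
    proof eventually_elim
      case (elim u)
      show ?case
      proof (rule ccontr)
        assume "u 0 $ i $ j \<noteq> -\<infinity>"
        then obtain x where x: "ereal x < u 0 $ i $ j" using ereal_dense2[of "-\<infinity>" "u 0 $ i $ j"] by auto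
        obtain K :: nat where "- x < real K" using reals_Archimedean2 by blast
        then have "ereal (- real K) < ereal x" by simp
        then have "ereal (- real K) < u 0 $ i $ j" using x by (rule less_trans)
        then show False using elim by blast
      qed
    qed
    then have "AE \<omega> in M. \<not> A 0 \<omega> $ i $ j \<noteq> -\<infinity>"
      using AE_path_lawD[OF A_measurable, of "\<lambda>u. u 0 $ i $ j = -\<infinity>"] by simp
    then have "base.prob {\<omega> \<in> space M. A 0 \<omega> $ i $ j \<noteq> -\<infinity>} = 0"
      by (subst base.prob_Collect_eq_0) auto
    then show False using assms by simp
  qed
  then obtain K :: nat where K: "\<not> (AE u in law. \<not> ereal (- real K) < u 0 $ i $ j)" by blast
  have Q: "whp law (\<lambda>n u. good u \<and> (ereal c < X_path n u j / ereal (real n) \<and>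
      X_path (Suc n) u i / ereal (real (Suc n)) < ereal b))"
    by (intro law.whp_conj law.whp_AE[OF AE_good] whp_greater[OF c(2)] whp_Suc[OF whp_less[OF b(1)]])
  have "eventually (\<lambda>n. \<exists>u. ereal (- real K) < (shift ^^ n) u 0 $ i $ j \<and>
      good u \<and> ereal c < X_path n u j / ereal (real n) \<and>
      X_path (Suc n) u i / ereal (real (Suc n)) < ereal b) sequentially"
    by (rule eventually_shifted_event_meets[OF _ K Q]) measurable
  then have "eventually (\<lambda>n. False) sequentially"
    using eventually_linear_gap(2)[OF c(1), of "real K"] eventually_gt_at_top[of 0]
  proof eventually_elim
    case (elim n)
    then obtain u where u: "ereal (- real K) < u n $ i $ j" "good u"
      "ereal c < X_path n u j / ereal (real n)"
      "X_path (Suc n) u i / ereal (real (Suc n)) < ereal b"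
      by (auto simp: funpow_shift)
    have "ereal (- real K + c * real n) = ereal (- real K) + ereal (c * real n)" by simp
    also have "\<dots> \<le> u n $ i $ j + X_path n u j"
      using u(1,3) elim(3) by (intro add_mono) (auto simp: ereal_less_divide_iff)
    also have "\<dots> \<le> X_path (Suc n) u i" by (rule X_path_Suc_ge[OF u(2)])
    also have "\<dots> < ereal (b * real (Suc n))"
      using u(4) ereal_divide_less_iff[of "Suc n" "X_path (Suc n) u i" b] by (metis zero_less_Suc)
    finally show ?case using elim(2) by simp
  qed
  then show False by simp
qed

lemma reach_limit_le:
  assumes "reach i j"
  shows "l j \<le> l i"
  using assms unfolding reach_iff
  by (induction rule: rtranclp_induct) (auto intro: order_trans edge_limit_le)

text \<open>An entry of the product over the component is at most the coordinate of
  \<open>x(n,0)\<close> at its row index. All nodes of the component have \<open>l\<close> at most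
  \<open>l i\<close>, so if \<open>l i < b < gam i\<close>, the maximal entry could not grow faster
  than \<open>b n\<close>.\<close>

lemma gam_le_limit: "gam i \<le> l i"
proof (rule ccontr)
  assume "\<not> gam i \<le> l i"
  then obtain b where b: "l i < ereal b" "ereal b < gam i" using ereal_dense2[of "l i" "gam i"] by (auto simp: not_le)
  have l_scc: "l j < ereal b" if "j \<in> scc i" for j
    using that reach_limit_le[of i j] b(1) by (auto simp: scc_def)
  have "scc i \<noteq> {}" using in_scc by blast
  then have "in_prob law (\<lambda>n u. top_entry (scc i) n u / ereal (real n)) (gam i)"
    unfolding gam_def by (intro law.AE_tendsto_imp_in_prob lyapunov_tendsto(2)) measurable
  then have top: "whp law (\<lambda>n u. ereal b < top_entry (scc i) n u / ereal (real n))"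
    using b(2) unfolding in_prob_def by blast
  have "whp law (\<lambda>n u. \<forall>j\<in>scc i. X_path n u j / ereal (real n) < ereal b)"
    by (intro law.whp_ball whp_less l_scc) auto
  then have "whp law (\<lambda>n u. good u \<and> (ereal b < top_entry (scc i) n u / ereal (real n) \<and>
      (\<forall>j\<in>scc i. X_path n u j / ereal (real n) < ereal b)))"
    by (intro law.whp_conj law.whp_AE[OF AE_good] top)
  from law.whp_exists[OF this] have "eventually (\<lambda>n. False) sequentially"
    using eventually_gt_at_top[of 0]
  proof eventually_elim
    case (elim n)
    then obtain u where u: "good u" "ereal (b * real n) < top_entry (scc i) n u"
      and X: "\<And>j. j \<in> scc i \<Longrightarrow> X_path n u j < ereal (b * real n)"
      by (auto simp: ereal_less_divide_iff ereal_divide_less_iff)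
    have fin: "\<And>t i j. u t $ i $ j \<noteq> \<infinity>" using u(1) by (simp add: good_def)
    have "top_entry (scc i) n u \<le> ereal (b * real n)"
      unfolding top_entry_def
    proof (intro SUP_least)
      fix j k assume jk: "j \<in> scc i" "k \<in> scc i"
      consider "mp_prod (scc i) u n $ j $ k = -\<infinity>" | q where "q 0 = j"
          "rev_weight u q n = mp_prod (scc i) u n $ j $ k"
        using mp_prod_attained[of u j "scc i" k n] fin jk by blast
      then show "mp_prod (scc i) u n $ j $ k \<le> ereal (b * real n)"
      proof cases
        case 2
        then have "mp_prod (scc i) u n $ j $ k \<le> X_path n u j"
          using rev_weight_le_X_path[of u q n] by simp
        also have "\<dots> \<le> ereal (b * real n)" using X[OF jk(1)] by simp
        finally show ?thesis .
      qed simp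
    qed
    then show ?case using u(2) by simp
  qed
  then show False by simp
qed

lemma limit_le_gamma_down: "l i \<le> gamma_down M A (scc i)"
proof (rule ccontr)
  assume "\<not> l i \<le> gamma_down M A (scc i)"
  then obtain c where c: "gamma_down M A (scc i) < ereal c" "ereal c < l i"
    using ereal_dense2[of "gamma_down M A (scc i)" "l i"] by (auto simp: not_le)
  have "whp law (\<lambda>n u. X_path n u i \<le> ereal (c * real n))"
    by (rule law.whp_AE_eventually[OF _ AE_X_path_upper[OF c(1)]]) measurable
  then have "whp law (\<lambda>n u. X_path n u i \<le> ereal (c * real n) \<and> ereal c < X_path n u i / ereal (real n))"
    by (intro law.whp_conj whp_greater[OF c(2)])
  from law.whp_exists[OF this] have "eventually (\<lambda>n. False) sequentially"
    using eventually_gt_at_top[of 0]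
    by eventually_elim (auto simp: ereal_less_divide_iff)
  then show False by simp
qed

lemma limit_eq_gamma_down: "l i = gamma_down M A (scc i)"
proof (rule antisym[OF limit_le_gamma_down])
  obtain j where j: "reach i j" "gam j = gamma_down M A (scc i)" by (rule gamma_down_attained)
  show "gamma_down M A (scc i) \<le> l i"
    using gam_le_limit[of j] reach_limit_le[OF j(1)] j(2) by simp
qed

text \<open>Suppose row \<open>i\<close> of the submatrix is \<open>-\<infinity>\<close> with
  positive probability. At such a time \<open>x\<^sub>i(n+1,0)\<close> is formed from successors
  outside \<open>H\<close>, where the limits are below some \<open>b\<close> smaller than
  \<open>l i\<close>. One bounded step cannot bridge this gap.\<close>

lemma no_bot_line_H_set: "no_bot_line M (H_set M A (scc i0)) (A 0)"
proof -
  define H where "H = H_set M A (scc i0)"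
  define \<gamma> where "\<gamma> = gamma_down M A (scc i0)"
  \<comment> \<open>By \<open>limit_eq_gamma_down\<close>, \<open>H\<close> consists of the
    reachable nodes at which the limit still has its value at \<open>i0\<close>. Leaving
    \<open>H\<close> along an arc makes the limit strictly smaller.\<close>
  have H_iff: "i \<in> H \<longleftrightarrow> reach i0 i \<and> l i = \<gamma>" for i
  proof
    assume "i \<in> H"
    then obtain k where k: "reach i0 i" "reach i k" "gam k = \<gamma>" unfolding H_def \<gamma>_def H_set_scc by blast
    have "gamma_down M A (scc i) = \<gamma>"
      using gamma_down_mono[OF k(1)] gam_le_gamma_down[OF k(2)] k(3) unfolding \<gamma>_def by simp
    then show "reach i0 i \<and> l i = \<gamma>" using k(1) limit_eq_gamma_down by simp
  next
    assume i: "reach i0 i \<and> l i = \<gamma>"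
    obtain k where "reach i k" "gam k = gamma_down M A (scc i)" by (rule gamma_down_attained)
    then show "i \<in> H" unfolding H_def H_set_scc using i limit_eq_gamma_down \<gamma>_def by auto
  qed
  have "AE u in law. \<exists>j\<in>H. u 0 $ i $ j \<noteq> -\<infinity>" if i: "i \<in> H" for i
  proof (rule ccontr)
    assume not_AE: "\<not> (AE u in law. \<exists>j\<in>H. u 0 $ i $ j \<noteq> -\<infinity>)"
    define J where "J = {j. edge i j \<and> j \<notin> H}"
    have l_J: "l j < \<gamma>" if "j \<in> J" for j
    proof -
      have "reach i j" "j \<notin> H" using that edge_reach by (auto simp: J_def)
      moreover have "reach i0 i" "l i = \<gamma>" using i H_iff by auto
      ultimately show ?thesis
        using reach_limit_le[of i j] reach_trans[of i0 i j] H_iff[of j] by auto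
    qed
    have J_ne: "J \<noteq> {}"
    proof
      assume J: "J = {}"
      have "AE u in law. \<exists>j\<in>H. u 0 $ i $ j \<noteq> -\<infinity>"
        using AE_good AE_edge
      proof eventually_elim
        case (elim u)
        then obtain j where "u 0 $ i $ j \<noteq> -\<infinity>" unfolding good_def by blast
        then show ?case using elim(2) J by (auto simp: J_def)
      qed
      then show False using not_AE by blast
    qed
    have "Max (l ` J) \<in> l ` J" using J_ne by (intro Max_in) auto
    then have "Max (l ` J) < \<gamma>" using l_J by auto
    then obtain b where b: "Max (l ` J) < ereal b" "ereal b < \<gamma>" using ereal_dense2 by blast
    then obtain c where c: "b < c" "ereal c < \<gamma>" using ereal_dense2[of "ereal b" \<gamma>] by auto
    have l_b: "l j < ereal b" if "j \<in> J" for j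
      by (rule le_less_trans[OF Max_ge b(1)]) (use that in auto)
    have l_c: "ereal c < l i" using c(2) H_iff[of i] i by simp
    \<comment> \<open>The entries must also be bounded by a fixed \<open>K\<close> on the event, so
      that the step into time \<open>n + 1\<close> is negligible against the linear gap.\<close>
    have "\<exists>K::nat. \<not> (AE u in law. \<not> ((\<forall>j\<in>H. u 0 $ i $ j = -\<infinity>) \<and> entry_bound u \<le> real K))"
    proof (rule ccontr)
      assume "\<not> ?thesis"
      then have "AE u in law. \<forall>K::nat. \<not> ((\<forall>j\<in>H. u 0 $ i $ j = -\<infinity>) \<and> entry_bound u \<le> real K)"
        by (subst AE_all_countable) blast
      then have "AE u in law. \<exists>j\<in>H. u 0 $ i $ j \<noteq> -\<infinity>"
      proof eventually_elim
        case (elim u)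
        obtain K :: nat where "entry_bound u \<le> real K" using real_arch_simple by blast
        then show ?case using elim by blast
      qed
      then show False using not_AE by blast
    qed
    then obtain K :: nat where K: "\<not> (AE u in law. \<not> ((\<forall>j\<in>H. u 0 $ i $ j = -\<infinity>) \<and> entry_bound u \<le> real K))"
      by blast
    have Q: "whp law (\<lambda>n u. good u \<and> ((\<forall>t i j. u t $ i $ j \<noteq> -\<infinity> \<longrightarrow> edge i j) \<and>
        ((\<forall>j\<in>J. X_path n u j / ereal (real n) < ereal b) \<and>
        ereal c < X_path (Suc n) u i / ereal (real (Suc n)))))"
      by (intro law.whp_conj law.whp_AE[OF AE_good] law.whp_AE[OF AE_edge] law.whp_ball whp_less l_b
          whp_Suc[OF whp_greater[OF l_c]]) auto
    have "eventually (\<lambda>n. \<exists>u. ((\<forall>j\<in>H. (shift ^^ n) u 0 $ i $ j = -\<infinity>) \<and> entry_bound ((shift ^^ n) u) \<le> real K) \<and>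
        good u \<and> (\<forall>t i j. u t $ i $ j \<noteq> -\<infinity> \<longrightarrow> edge i j) \<and>
        (\<forall>j\<in>J. X_path n u j / ereal (real n) < ereal b) \<and>
        ereal c < X_path (Suc n) u i / ereal (real (Suc n))) sequentially"
      by (rule eventually_shifted_event_meets[OF _ K Q]) measurable
    then have "eventually (\<lambda>n. False) sequentially"
      using eventually_linear_gap(1)[OF c(1), of "real K"] eventually_gt_at_top[of 0]
    proof eventually_elim
      case (elim n)
      then obtain u where u: "\<forall>j\<in>H. u n $ i $ j = -\<infinity>" "entry_bound ((shift ^^ n) u) \<le> real K" "good u"
        "\<forall>t i j. u t $ i $ j \<noteq> -\<infinity> \<longrightarrow> edge i j"
        "\<forall>j\<in>J. X_path n u j / ereal (real n) < ereal b"
        "ereal c < X_path (Suc n) u i / ereal (real (Suc n))"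
        by (auto simp: funpow_shift)
      obtain k where k: "X_path (Suc n) u i \<le> u n $ i $ k + X_path n u k"
        by (rule X_path_Suc_le[OF u(3)])
      have lower: "ereal (c * real (Suc n)) < X_path (Suc n) u i"
        using u(6) ereal_less_divide_iff[of "Suc n" c] by (metis zero_less_Suc)
      have "good ((shift ^^ n) u)" using u(3) by (auto simp: good_def funpow_shift)
      then have "(shift ^^ n) u 0 $ i $ k \<le> ereal (entry_bound ((shift ^^ n) u))"
        by (intro entry_le_bound) (simp add: good_def)
      then have entry: "u n $ i $ k \<le> ereal (real K)"
        using u(2) by (auto simp: funpow_shift intro: order_trans)
      \<comment> \<open>Since \<open>-\<infinity> + \<infinity>\<close> is
        \<open>\<infinity>\<close> in \<open>ereal\<close>, this has to be excluded before the
        finite lower bound on the sum shows that the entry is not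
        \<open>-\<infinity>\<close>.\<close>
      have "X_path n u k \<noteq> \<infinity>"
      proof -
        obtain q where "rev_weight u q n = X_path n u k"
          using X_path_attained[of u k n] u(3) by (auto simp: good_def)
        moreover have "rev_weight u q n \<noteq> \<infinity>"
          using u(3) by (simp add: rev_weight_def sum_Pinfty good_def)
        ultimately show ?thesis by simp
      qed
      then have "u n $ i $ k \<noteq> -\<infinity>"
        using k lower by (cases "X_path n u k") auto
      then have "k \<in> J" using u(1,4) by (auto simp: J_def)
      then have "X_path n u k \<le> ereal (b * real n)"
        using u(5) elim(3) by (simp add: ereal_divide_less_iff less_imp_le)
      then have "u n $ i $ k + X_path n u k \<le> ereal (real K) + ereal (b * real n)"
        using entry by (intro add_mono)
      with lower k have "ereal (c * real (Suc n)) < ereal (real K) + ereal (b * real n)"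
        by (meson less_le_trans order_trans)
      then show ?case using elim(2) by simp
    qed
    then show False by simp
  qed
  then have "AE u in law. \<forall>i\<in>H. \<exists>j\<in>H. u 0 $ i $ j \<noteq> -\<infinity>"
    by (subst AE_ball_countable) auto
  from AE_path_lawD[OF A_measurable this] show ?thesis by (simp add: no_bot_line_def H_def)
qed

end

end

text \<open>Expresses convergence through two measurable functions, which makes the event of
  convergence measurable.\<close>

lemma ereal_limit_exists_iff:
  fixes X :: "nat \<Rightarrow> ereal"
  shows "(\<exists>l. l \<noteq> \<infinity> \<and> X \<longlonglongrightarrow> l) \<longleftrightarrow> liminf X = limsup X \<and> limsup X \<noteq> \<infinity>"
proof
  assume "\<exists>l. l \<noteq> \<infinity> \<and> X \<longlonglongrightarrow> l"
  then obtain l where "l \<noteq> \<infinity>" "X \<longlonglongrightarrow> l" by blast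
  then show "liminf X = limsup X \<and> limsup X \<noteq> \<infinity>"
    using lim_imp_Liminf[of sequentially X l] lim_imp_Limsup[of sequentially X l] by simp
next
  assume "liminf X = limsup X \<and> limsup X \<noteq> \<infinity>"
  then show "\<exists>l. l \<noteq> \<infinity> \<and> X \<longlonglongrightarrow> l"
    using Liminf_eq_Limsup[of sequentially X] by (auto intro!: exI[of _ "limsup X"])
qed

section \<open>The two-sided extension\<close>

text \<open>Starts the two-sided path at time \<open>-n\<close>, so that its first \<open>n\<close>
  matrices are \<open>B (-n), \<dots>, B (-1)\<close> and their product is the one in
  \<open>y(n,0)\<close>.\<close>

definition backward :: "nat \<Rightarrow> (int \<Rightarrow> 'b) \<Rightarrow> nat \<Rightarrow> 'b" where
  "backward n v = (\<lambda>k. v (int k - int n))"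

lemma backward_measurable [measurable]:
  "backward n \<in> measurable (paths :: (int \<Rightarrow> 'b::topological_space) measure) paths"
  unfolding backward_def by (rule path_measurable) measurable

lemma y_seq_eq: "y_seq B n \<omega> $ i = X_path n (backward n (\<lambda>t. B t \<omega>)) i"
  by (simp add: y_seq_def X_path_def backward_def)

lemma x_seq_eq: "x_seq A n \<omega> $ i = X_path n (\<lambda>k. A k \<omega>) i"
  by (simp add: x_seq_def X_path_def)

definition unshift :: "(int \<Rightarrow> 'b) \<Rightarrow> int \<Rightarrow> 'b" where
  "unshift v = (\<lambda>t. v (t - 1))"

lemma unshift_measurable [measurable]:
  "unshift \<in> measurable (paths :: (int \<Rightarrow> 'b::topological_space) measure) paths"
  unfolding unshift_def by (rule path_measurable) measurable

lemma funpow_unshift: "(unshift ^^ k) v = (\<lambda>t. v (t - int k))"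
  by (induction k arbitrary: v) (auto simp: unshift_def algebra_simps)

text \<open>For \<open>y(n,0)\<close> the walk starts with \<open>B (-1)\<close> and moves into the
  past. It is driven by the backward shift directly, with no reversal and no transposition.\<close>

definition last_matrix :: "(int \<Rightarrow> ereal^'d^'d) \<Rightarrow> 'd \<Rightarrow> 'd \<Rightarrow> ereal" where
  "last_matrix v i j = v (-1) $ i $ j"

lemma walk_weight_unshift: "walk_weight unshift last_matrix v p n = rev_weight (backward n v) p n"
  unfolding walk_weight_def rev_weight_def funpow_unshift last_matrix_def backward_def
  by (intro sum.cong refl) (simp add: of_nat_diff)

lemma max_walk_unshift:
  fixes v :: "int \<Rightarrow> ereal^'d^'d"
  assumes "\<And>t i j. v t $ i $ j \<noteq> \<infinity>"
  shows "max_walk unshift last_matrix n v i = X_path n (backward n v) i"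
proof (rule antisym)
  show "max_walk unshift last_matrix n v i \<le> X_path n (backward n v) i"
    unfolding max_walk_le_iff walk_weight_unshift by (auto intro: rev_weight_le_X_path)
  obtain q where q: "q 0 = i" "rev_weight (backward n v) q n = X_path n (backward n v) i"
    using X_path_attained[of "backward n v" i n] assms by (auto simp: backward_def)
  then show "X_path n (backward n v) i \<le> max_walk unshift last_matrix n v i"
    using walk_weight_le[of unshift last_matrix v q n] by (simp add: walk_weight_unshift)
qed

section \<open>Transfer between the sequence and its two-sided extension\<close>

context mp_sequence
begin

text \<open>The limit in the assumption may be random. Measurability of the event of convergence
  moves the assumption to the path law, where \<open>AE_limit_const\<close> applies coordinate by
  coordinate.\<close>

lemma AE_X_path_const:
  assumes "AE \<omega> in M. \<exists>l. \<forall>i. rmax_lim (\<lambda>n. x_seq A n \<omega> $ i / ereal (real n)) (l i)"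
  obtains l where "l \<noteq> \<infinity>" "AE u in law. (\<lambda>n. X_path n u i / ereal (real n)) \<longlonglongrightarrow> l"
proof (rule AE_limit_const[of "\<lambda>n u. X_path n u i"])
  show "AE u in law. \<exists>l. l \<noteq> \<infinity> \<and> (\<lambda>n. X_path n u i / ereal (real n)) \<longlonglongrightarrow> l"
  proof (subst AE_path_law_iff[OF A_measurable])
    show "Measurable.pred paths (\<lambda>u. \<exists>l. l \<noteq> \<infinity> \<and> (\<lambda>n. X_path n u i / ereal (real n)) \<longlonglongrightarrow> l)"
    proof -
      have X [measurable]: "(\<lambda>u. X_path n u i / ereal (real n)) \<in> borel_measurable paths" for n
        by measurable
      have pred: "Measurable.pred paths (\<lambda>u. f u = g u \<and> g u \<noteq> \<infinity>)"
        if [measurable]: "f \<in> borel_measurable paths" "g \<in> borel_measurable paths"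
        for f g :: "(nat \<Rightarrow> ereal^'d^'d) \<Rightarrow> ereal"
      proof -
        have "{u \<in> space paths. f u = g u} - {u \<in> space paths. g u = \<infinity>} \<in> sets paths"
          by measurable
        also have "{u \<in> space paths. f u = g u} - {u \<in> space paths. g u = \<infinity>}
            = {u \<in> space paths. f u = g u \<and> g u \<noteq> \<infinity>}" by auto
        finally show ?thesis by (simp only: pred_def)
      qed
      show ?thesis
        unfolding ereal_limit_exists_iff
        by (rule pred; rule borel_measurable_liminf borel_measurable_limsup; rule X)
    qed
    show "AE \<omega> in M. \<exists>l. l \<noteq> \<infinity> \<and> (\<lambda>n. X_path n (\<lambda>t. A t \<omega>) i / ereal (real n)) \<longlonglongrightarrow> l"
      using assms by eventually_elim (auto simp: rmax_lim_def x_seq_eq)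
  qed
  have le: "X_path (Suc n) u i \<le> ereal (entry_bound u) + X_path n (shift u) i" if "good u" for n u
  proof -
    have u: "\<And>t i j. u t $ i $ j \<noteq> \<infinity>" using that by (simp add: good_def)
    obtain q where q: "q 0 = i" "rev_weight u q (Suc n) = X_path (Suc n) u i"
      using X_path_attained[of u i "Suc n"] u by blast
    have "X_path (Suc n) u i \<le> ereal (entry_bound u) + rev_weight (shift u) q n"
      unfolding q(2)[symmetric] by (intro rev_weight_Suc_le entry_le_bound u)
    also have "\<dots> \<le> ereal (entry_bound u) + X_path n (shift u) i"
      using rev_weight_le_X_path[of "shift u" q n] q(1) by (intro add_left_mono) simp
    finally show ?thesis .
  qed
  show "AE u in law. \<exists>K::real. \<forall>n. X_path (Suc n) u i \<le> ereal K + X_path n (shift u) i"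
    using AE_good by eventually_elim (use le in blast)
qed (rule X_path_borel, erule (1) that)

context
  fixes N :: "'b measure" and B :: "int \<Rightarrow> 'b \<Rightarrow> ereal^'d^'d"
  assumes ext: "stationary_extension M A N B"
begin

lemma prob_space_N: "prob_space N"
  and B_measurable [measurable]: "\<And>n. B n \<in> borel_measurable N"
  and B_neq_PInf: "\<And>\<omega> n i j. \<omega> \<in> space N \<Longrightarrow> B n \<omega> $ i $ j \<noteq> \<infinity>"
  and stationary_B: "Defs.stationary N B"
  and law_B: "path_law N (\<lambda>n. B (int n)) = law"
  using ext by (auto simp: stationary_extension_def rmax_random_matrix_def)

text \<open>Induction on \<open>n\<close>: shifting the two-sided path by one turns
  \<open>backward (Suc n)\<close> into \<open>backward n\<close>, and stationarity makes the shift
  invisible in law.\<close>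

lemma distr_backward: "distr (path_law N B) paths (backward n) = law"
proof (induction n)
  case 0
  have "distr (path_law N B) paths (backward 0) = path_law N (\<lambda>n. B (int n))"
    by (subst distr_path_law) (auto simp: B_measurable path_law_def backward_def)
  then show ?case by (simp add: law_B)
next
  case (Suc n)
  have "distr (path_law N B) paths (backward (Suc n))
      = distr (distr (path_law N B) paths shift) paths (backward (Suc n))"
    by (simp add: stationary_distr_shift[OF B_measurable stationary_B])
  also have "\<dots> = distr (path_law N B) paths (backward (Suc n) \<circ> shift)"
    by (rule distr_distr) measurable
  also have "backward (Suc n) \<circ> shift = (backward n :: (int \<Rightarrow> ereal^'d^'d) \<Rightarrow> _)"
    by (auto simp: backward_def shift_def fun_eq_iff algebra_simps)
  finally show ?case using Suc by simp
qed

lemma y_measurable [measurable]: "(\<lambda>\<omega>. y_seq B n \<omega> $ i / ereal (real n)) \<in> borel_measurable N"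
proof -
  have "(\<lambda>\<omega>. X_path n (backward n (\<lambda>t. B t \<omega>)) i) \<in> borel_measurable N"
    by (intro measurable_compose[OF _ X_path_borel] measurable_compose[OF _ backward_measurable]
        path_measurable B_measurable)
  then show ?thesis unfolding y_seq_eq by measurable
qed

lemma distr_y_seq:
  "distr N borel (\<lambda>\<omega>. y_seq B n \<omega> $ i / ereal (real n)) = distr law borel (\<lambda>u. X_path n u i / ereal (real n))"
proof -
  have "distr law borel (\<lambda>u. X_path n u i / ereal (real n))
      = distr (distr (path_law N B) paths (backward n)) borel (\<lambda>u. X_path n u i / ereal (real n))"
    by (simp only: distr_backward)
  also have "\<dots> = distr (path_law N B) borel ((\<lambda>u. X_path n u i / ereal (real n)) \<circ> backward n)"
    by (rule distr_distr) measurable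
  also have "\<dots> = distr N borel (\<lambda>\<omega>. y_seq B n \<omega> $ i / ereal (real n))"
    by (subst distr_path_law) (auto simp: y_seq_eq B_measurable o_def)
  finally show ?thesis by simp
qed

lemma in_prob_law_iff:
  "in_prob law (\<lambda>n u. X_path n u i / ereal (real n)) l \<longleftrightarrow>
   in_prob N (\<lambda>n \<omega>. y_seq B n \<omega> $ i / ereal (real n)) l"
  by (rule iffI; rule in_prob_distr_cong[rotated 5], assumption)
     (auto simp: distr_y_seq prob_space_N law.prob_space_axioms)

text \<open>The theorem of Bousch and Mairesse, obtained by applying
  \<open>AE_max_walk_converges\<close> to the backward shift. Convergence is almost sure here
  because \<open>y(n,0)\<close> is a maximum over walks from a fixed starting point of the
  orbit.\<close>

lemma AE_y_converges: "AE \<omega> in N. \<exists>l. (\<lambda>n. y_seq B n \<omega> $ i / ereal (real n)) \<longlonglongrightarrow> l"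
proof -
  interpret P: prob_space "path_law N B"
    unfolding path_law_def
    by (intro prob_space.prob_space_distr prob_space_N path_measurable B_measurable)
  have unshift_shift: "unshift \<circ> shift = (id :: (int \<Rightarrow> ereal^'d^'d) \<Rightarrow> _)"
    by (auto simp: unshift_def shift_def fun_eq_iff)
  have "AE v in path_law N B. good (backward 1 v)"
    using AE_good by (intro AE_distrD[of "backward 1" "path_law N B" paths]) (simp_all only: distr_backward, measurable)
  \<comment> \<open>The backward shift preserves the law as the inverse of the shift. Entry 0 of
    \<open>backward 1 v\<close> is \<open>v (-1)\<close>, so the dominating function bounds the
    entries of the first matrix that a walk uses.\<close>
  interpret P: walk_system "path_law N B" unshift last_matrix "\<lambda>v. entry_bound (backward 1 v)"
  proof
    show "unshift \<in> measurable (path_law N B) (path_law N B)" by (simp cong: measurable_cong_sets)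
    have "distr (path_law N B) (path_law N B) unshift = distr (distr (path_law N B) paths shift) paths unshift"
      by (simp add: stationary_distr_shift[OF B_measurable stationary_B]) (rule distr_cong, simp_all)
    also have "\<dots> = distr (path_law N B) paths (unshift \<circ> shift)"
      by (rule distr_distr) measurable
    also have "\<dots> = path_law N B" unfolding unshift_shift id_def by (rule distr_id2) simp
    finally show "distr (path_law N B) (path_law N B) unshift = path_law N B" .
    show "(\<lambda>v. last_matrix v i j) \<in> borel_measurable (path_law N B)" for i j
      unfolding last_matrix_def by measurable
    have "integrable (distr (path_law N B) paths (backward 1)) entry_bound"
      unfolding distr_backward by (rule law.g_integrable)
    then show "integrable (path_law N B) (\<lambda>v. entry_bound (backward 1 v))"
      by (rule integrable_distr[rotated]) measurable
    show "0 \<le> entry_bound (backward 1 v)" for v by (rule entry_bound_nonneg)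
    show "AE v in path_law N B. \<forall>i j. last_matrix v i j \<le> ereal (entry_bound (backward 1 v))"
      using \<open>AE v in path_law N B. good (backward 1 v)\<close>
    proof eventually_elim
      case (elim v)
      have "backward 1 v 0 $ i $ j \<le> ereal (entry_bound (backward 1 v))" for i j
        using elim by (intro entry_le_bound) (simp add: good_def)
      then show ?case by (simp add: last_matrix_def backward_def)
    qed
  qed
  have "AE \<omega> in N. \<forall>i. \<exists>l. l \<noteq> \<infinity> \<and>
      (\<lambda>n. max_walk unshift last_matrix n (\<lambda>t. B t \<omega>) i / ereal (real n)) \<longlonglongrightarrow> l"
    by (rule AE_path_lawD[OF B_measurable P.AE_max_walk_converges])
  with AE_space show ?thesis
  proof eventually_elim
    case (elim \<omega>)
    have eq: "max_walk unshift last_matrix n (\<lambda>t. B t \<omega>) i = y_seq B n \<omega> $ i" for n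
      unfolding y_seq_eq by (rule max_walk_unshift) (rule B_neq_PInf[OF elim(1)])
    from elim(2) obtain l where "(\<lambda>n. max_walk unshift last_matrix n (\<lambda>t. B t \<omega>) i / ereal (real n)) \<longlonglongrightarrow> l"
      by blast
    then show ?case unfolding eq by blast
  qed
qed

end

lemma AE_scc_limit:
  assumes "\<And>i. AE \<omega> in N. (\<lambda>n. z n \<omega> i / ereal (real n)) \<longlonglongrightarrow> gamma_down M A (scc i)" "c \<in> sccs_of M A"
  shows "AE \<omega> in N. \<forall>i\<in>c. rmax_lim (\<lambda>n. z n \<omega> i / ereal (real n)) (gamma_down M A c)"
proof -
  have "AE \<omega> in N. \<forall>i. (\<lambda>n. z n \<omega> i / ereal (real n)) \<longlonglongrightarrow> gamma_down M A (scc i)"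
    using assms(1) by (subst AE_all_countable) blast
  then show ?thesis
  proof eventually_elim
    case (elim \<omega>)
    show ?case
    proof
      fix i assume "i \<in> c"
      then have "c = scc i" using scc_eq assms(2) by blast
      then show "rmax_lim (\<lambda>n. z n \<omega> i / ereal (real n)) (gamma_down M A c)"
        using elim gamma_down_neq_PInf by (simp add: rmax_lim_def)
    qed
  qed
qed

end

theorem theorem2p3:
  fixes M :: "'a measure" and A :: "nat \<Rightarrow> 'a \<Rightarrow> ereal^'d^'d"
    and N :: "'b measure" and B :: "int \<Rightarrow> 'b \<Rightarrow> ereal^'d^'d"
  assumes "prob_space M"
    and "\<And>n. rmax_random_matrix M (A n)"
    and "stationary M A"
    and "ergodic M A"
    and "no_bot_line M UNIV (A 0)"
    and "integrable M (\<lambda>\<omega>. real_of_ereal (MAX i. MAX j. max (A 0 \<omega> $ i $ j) 0))"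
  shows
    "(stationary_extension M A N B \<and>
      (\<exists>l. AE \<omega> in N. \<forall>i. rmax_lim (\<lambda>n. y_seq B n \<omega> $ i / ereal (real n)) (l i)) \<longrightarrow>
        (\<forall>c\<in>sccs_of M A. AE \<omega> in N. \<forall>i\<in>c.
           rmax_lim (\<lambda>n. y_seq B n \<omega> $ i / ereal (real n)) (gamma_down M A c)) \<and>
        (\<forall>c\<in>sccs_of M A. no_bot_line M (H_set M A c) (A 0))) \<and>
     ((AE \<omega> in M. \<exists>l. \<forall>i. rmax_lim (\<lambda>n. x_seq A n \<omega> $ i / ereal (real n)) (l i)) \<longrightarrow>
        (\<forall>c\<in>sccs_of M A. AE \<omega> in M. \<forall>i\<in>c.
           rmax_lim (\<lambda>n. x_seq A n \<omega> $ i / ereal (real n)) (gamma_down M A c)) \<and>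
        (stationary_extension M A N B \<longrightarrow>
          (\<forall>c\<in>sccs_of M A. AE \<omega> in N. \<forall>i\<in>c.
             rmax_lim (\<lambda>n. y_seq B n \<omega> $ i / ereal (real n)) (gamma_down M A c))))"
proof -
  interpret mp_sequence M A by (rule mp_sequence.intro) fact+
  show ?thesis
  proof (intro conjI impI; (elim conjE exE)?)
    fix l
    assume ext: "stationary_extension M A N B"
      and l: "AE \<omega> in N. \<forall>i. rmax_lim (\<lambda>n. y_seq B n \<omega> $ i / ereal (real n)) (l i)"
    have lim: "AE \<omega> in N. (\<lambda>n. y_seq B n \<omega> $ i / ereal (real n)) \<longlonglongrightarrow> l i" for i
      using l by eventually_elim (simp add: rmax_lim_def)
    \<comment> \<open>For each \<open>n\<close>, \<open>y(n,0)\<close> has the law of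
      \<open>x(n,0)\<close> under the path law, so the results on limits in probability become
      available.\<close>
    have in_prob: "in_prob law (\<lambda>n u. X_path n u i / ereal (real n)) (l i)" for i
      unfolding in_prob_law_iff[OF ext]
      by (intro prob_space.AE_tendsto_imp_in_prob prob_space_N[OF ext] y_measurable[OF ext] lim)
    show "\<forall>c\<in>sccs_of M A. AE \<omega> in N. \<forall>i\<in>c.
        rmax_lim (\<lambda>n. y_seq B n \<omega> $ i / ereal (real n)) (gamma_down M A c)"
      using AE_scc_limit[where N = N and z = "\<lambda>n \<omega> i. y_seq B n \<omega> $ i"] lim limit_eq_gamma_down[OF in_prob] by auto
    show "\<forall>c\<in>sccs_of M A. no_bot_line M (H_set M A c) (A 0)"
    proof
      fix c assume "c \<in> sccs_of M A"
      then obtain i where "c = scc i" unfolding sccs_of_iff scc_def by blast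
      then show "no_bot_line M (H_set M A c) (A 0)" using no_bot_line_H_set[OF in_prob] by simp
    qed
  next
    assume conv: "AE \<omega> in M. \<exists>l. \<forall>i. rmax_lim (\<lambda>n. x_seq A n \<omega> $ i / ereal (real n)) (l i)"
    \<comment> \<open>The assumed limit may depend on \<open>\<omega>\<close>; ergodicity makes each
      coordinate constant.\<close>
    have "\<exists>l. AE u in law. (\<lambda>n. X_path n u i / ereal (real n)) \<longlonglongrightarrow> l" for i
      by (rule AE_X_path_const[OF conv, of i]) blast
    then have "\<forall>i. \<exists>l. AE u in law. (\<lambda>n. X_path n u i / ereal (real n)) \<longlonglongrightarrow> l" by blast
    from choice[OF this] obtain l where
      l: "\<And>i. AE u in law. (\<lambda>n. X_path n u i / ereal (real n)) \<longlonglongrightarrow> l i"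
      by blast
    have in_prob: "in_prob law (\<lambda>n u. X_path n u i / ereal (real n)) (l i)" for i
      by (rule law.AE_tendsto_imp_in_prob[OF _ l[of i]]) measurable
    note l_eq = limit_eq_gamma_down[OF in_prob]
    have "AE \<omega> in M. (\<lambda>n. x_seq A n \<omega> $ i / ereal (real n)) \<longlonglongrightarrow> gamma_down M A (scc i)" for i
      unfolding x_seq_eq using AE_path_lawD[OF A_measurable l[of i]] l_eq[of i] by simp
    then show "\<forall>c\<in>sccs_of M A. AE \<omega> in M. \<forall>i\<in>c.
        rmax_lim (\<lambda>n. x_seq A n \<omega> $ i / ereal (real n)) (gamma_down M A c)"
      using AE_scc_limit[where N = M and z = "\<lambda>n \<omega> i. x_seq A n \<omega> $ i"] by auto
    assume ext: "stationary_extension M A N B"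
    \<comment> \<open>Equality in law carries over only convergence in probability. Together with
      the almost sure existence of a limit from \<open>AE_y_converges\<close> it identifies that
      limit.\<close>
    have "AE \<omega> in N. (\<lambda>n. y_seq B n \<omega> $ i / ereal (real n)) \<longlonglongrightarrow> gamma_down M A (scc i)" for i
      using in_prob[of i] unfolding l_eq in_prob_law_iff[OF ext]
      by (rule prob_space.in_prob_AE_unique[OF prob_space_N[OF ext] y_measurable[OF ext] _ AE_y_converges[OF ext]])
    then show "\<forall>c\<in>sccs_of M A. AE \<omega> in N. \<forall>i\<in>c.
        rmax_lim (\<lambda>n. y_seq B n \<omega> $ i / ereal (real n)) (gamma_down M A c)"
      using AE_scc_limit[where N = N and z = "\<lambda>n \<omega> i. y_seq B n \<omega> $ i"] by auto
  qed
qed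

end
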